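(* Let $D$ be an infinite, connected, distance-transitive, weakly descendant-homogeneous digraph of finite out-valency $m>1$ with no directed cycles. Suppose the reachability relation on the edges of $D$ is not universal and that the alternets of $D$ belong to $\mathcal{C}$. Then the relation $\delta$ on $D$ is non-trivial and the quotient digraph $D/\delta$ is a directed tree with out-valency $1$ and in-valency $k$, where $k$ is the number of $\delta$-classes in the set of sources of an alternet. In particular, if the alternets of $D$ are isomorphic to $\Sigma(m,M)$ for some integer $M\ge m$ or $M=\aleph_0$, then $D$ is isomorphic to $D(m,M)$.
   Context: Digraphs have no loops; subdigraphs are induced. An $s$-arc ($s\ge0$) from $u$ to $v$ is a sequence $u_0\dots u_s$ with $u_0=u$, $u_s=v$, $(u_i,u_{i+1})$ edges, and $u_{i-1}\ne u_{i+1}$ for $0<i<s$; $D^s(u)$ is the set of endpoints of $s$-arcs from $u$, $\mathrm{desc}(u)=\bigcup_sD^s(u)$, $\mathrm{desc}(X)=\bigcup_{x\in X}\mathrm{desc}(x)$. Distance-transitive: for each $s\ge0$, $\mathrm{Aut}(D)$ is transitive on pairs $(u,v)$ with an $s$-arc but no shorter arc from $u$ to $v$. Weakly descendant-homogeneous: vertex transitive, and for finite vertex sets $X,Y$ and any isomorphism $f$ between the induced subdigraphs on $\mathrm{desc}(X)$, $\mathrm{desc}(Y)$ there is an automorphism agreeing with $f$ on $X$. Directed cycle: $u_0,\dots,u_n=u_0$ ($n\ge1$) with consecutive edges. Alternating walk: $x_0\dots x_n$ such that either $(x_{2i-1},x_{2i})$ and $(x_{2i+1},x_{2i})$ are edges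 for all relevant $i$, or $(x_{2i},x_{2i-1})$ and $(x_{2i},x_{2i+1})$ are edges for all relevant $i$. Edge $e$ reaches $e'$ if some alternating walk $x_0\dots x_n$ has $e=(x_0,x_1)$, $e'\in\{(x_{n-1},x_n),(x_n,x_{n-1})\}$; this equivalence relation is universal if it has one class. An alternet is the subdigraph spanned by one class; its sources/sinks are the tails/heads of its edges. $\delta(u,v)$ iff $u,v$ have the same out-neighbours; $D/\delta$ has the $\delta$-classes as vertices and an edge $(\mathbf{a},\mathbf{b})$ iff some $a\in\mathbf{a},b\in\mathbf{b}$ form an edge. Class $\mathcal{C}$: bipartite digraphs with parts $X$ (sources), $Y$ (sinks), edges from $X$ to $Y$, no isolated vertices, $X,Y$ finite non-empty, edge transitive, $\delta$ non-trivial on $X$, and $|Y|$ equal to the size of the $\delta$-classes in $X$. For $m\ge1$ and $M$ an integer $\ge m$ or $M=\aleph_0$: let $\Omega$ be a set of size $M$ and $S$ the set of $m$-element subsets of $\Omega$. $\Sigma(m,M)$ is the bipartite digraph with sources $S\times\Omega$, sinks $\Omega$, and an edge from $(s,c)$ to $a$ iff $a\in s$. $D(m,M)$: let $T$ be the infinite regular directed tree with out-valency $1$ and in-valency $|S|$; for each vertex $t$ of $T$ fix a bijection between the in-neighbours of $t$ and $S$; $D(m,M)$ has vertex set $T\times\Omega$ and edges $((t',c),(t,a))$ for all edges $(t',t)$ of $T$, all $c\in\Omega$, and all $a$ in the $m$-subset corresponding to $t'$. *)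

theory Defs
  imports "Graph_Theory.Graph_Theory" "HOL-Library.Extended_Nat"
begin

section \<open>Isomorphisms and transitivity\<close>

text \<open>For digraphs without parallel arcs an isomorphism is a map of vertices. The library relation
  \<^const>\<open>digraph_iso\<close> says that there is one; see \<open>digraph_iso_iff\<close> below.\<close>

definition dg_isom :: "('a \<Rightarrow> 'c) \<Rightarrow> ('a, 'b) pre_digraph \<Rightarrow> ('c, 'd) pre_digraph \<Rightarrow> bool" where
  "dg_isom f G H \<longleftrightarrow> bij_betw f (verts G) (verts H) \<and>
     (\<forall>u\<in>verts G. \<forall>v\<in>verts G. u \<rightarrow>\<^bsub>G\<^esub> v \<longleftrightarrow> f u \<rightarrow>\<^bsub>H\<^esub> f v)"

definition automorphism :: "'a pair_pre_digraph \<Rightarrow> ('a \<Rightarrow> 'a) \<Rightarrow> bool" where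
  "automorphism D g \<longleftrightarrow> dg_isom g (with_proj D) (with_proj D)"

definition vertex_transitive :: "'a pair_pre_digraph \<Rightarrow> bool" where
  "vertex_transitive D \<longleftrightarrow>
     (\<forall>u\<in>pverts D. \<forall>v\<in>pverts D. \<exists>g. automorphism D g \<and> g u = v)"

definition edge_transitive :: "'a pair_pre_digraph \<Rightarrow> bool" where
  "edge_transitive D \<longleftrightarrow>
     (\<forall>(u, v)\<in>parcs D. \<forall>(u', v')\<in>parcs D. \<exists>g. automorphism D g \<and> g u = u' \<and> g v = v')"

section \<open>Arcs and descendants\<close>

definition s_arc :: "'a pair_pre_digraph \<Rightarrow> nat \<Rightarrow> 'a \<Rightarrow> 'a \<Rightarrow> 'a list \<Rightarrow> bool" where
  "s_arc D s u v xs \<longleftrightarrow> length xs = s + 1 \<and> set xs \<subseteq> pverts D \<and> xs ! 0 = u \<and> xs ! s = v \<and>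
     (\<forall>i<s. (xs ! i, xs ! (i + 1)) \<in> parcs D) \<and>
     (\<forall>i. 0 < i \<and> i < s \<longrightarrow> xs ! (i - 1) \<noteq> xs ! (i + 1))"

definition desc_at :: "'a pair_pre_digraph \<Rightarrow> nat \<Rightarrow> 'a \<Rightarrow> 'a set" where
  "desc_at D s u = {v. \<exists>xs. s_arc D s u v xs}"

definition desc :: "'a pair_pre_digraph \<Rightarrow> 'a \<Rightarrow> 'a set" where
  "desc D u = (\<Union>s. desc_at D s u)"

definition desc_set :: "'a pair_pre_digraph \<Rightarrow> 'a set \<Rightarrow> 'a set" where
  "desc_set D X = (\<Union>x\<in>X. desc D x)"

definition at_distance :: "'a pair_pre_digraph \<Rightarrow> nat \<Rightarrow> 'a \<Rightarrow> 'a \<Rightarrow> bool" where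
  "at_distance D s u v \<longleftrightarrow> v \<in> desc_at D s u \<and> (\<forall>r<s. v \<notin> desc_at D r u)"

definition distance_transitive :: "'a pair_pre_digraph \<Rightarrow> bool" where
  "distance_transitive D \<longleftrightarrow>
     (\<forall>s u v u' v'. at_distance D s u v \<and> at_distance D s u' v' \<longrightarrow>
        (\<exists>g. automorphism D g \<and> g u = u' \<and> g v = v'))"

definition weakly_descendant_homogeneous :: "'a pair_pre_digraph \<Rightarrow> bool" where
  "weakly_descendant_homogeneous D \<longleftrightarrow> vertex_transitive D \<and>
     (\<forall>X Y f. finite X \<and> X \<subseteq> pverts D \<and> finite Y \<and> Y \<subseteq> pverts D \<and>
        dg_isom f (with_proj D \<restriction> desc_set D X) (with_proj D \<restriction> desc_set D Y) \<longrightarrow>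
        (\<exists>g. automorphism D g \<and> (\<forall>x\<in>X. g x = f x)))"

section \<open>Valencies and directed trees\<close>

definition has_out_valency :: "'a pair_pre_digraph \<Rightarrow> nat \<Rightarrow> bool" where
  "has_out_valency D k \<longleftrightarrow>
     (\<forall>v\<in>pverts D. finite (out_arcs (with_proj D) v) \<and> out_degree (with_proj D) v = k)"

definition has_in_valency :: "'a pair_pre_digraph \<Rightarrow> nat \<Rightarrow> bool" where
  "has_in_valency D k \<longleftrightarrow>
     (\<forall>v\<in>pverts D. finite (in_arcs (with_proj D) v) \<and> in_degree (with_proj D) v = k)"

text \<open>A directed tree is an orientation of an undirected tree. The library's
  \<^const>\<open>tree\<close> does not express this: it only excludes directed cycles.\<close>

definition undirected_cycle :: "'a pair_pre_digraph \<Rightarrow> 'a list \<Rightarrow> bool" where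
  "undirected_cycle D xs \<longleftrightarrow> 3 \<le> length xs \<and> distinct xs \<and>
     (\<forall>i<length xs.
        (xs ! i, xs ! ((i + 1) mod length xs)) \<in> parcs (mk_symmetric (with_proj D)))"

definition directed_tree :: "'a pair_pre_digraph \<Rightarrow> bool" where
  "directed_tree D \<longleftrightarrow> pair_loopfree_digraph D \<and> connected (with_proj D) \<and>
     (\<forall>u v. (u, v) \<in> parcs D \<longrightarrow> (v, u) \<notin> parcs D) \<and> (\<nexists>xs. undirected_cycle D xs)"

section \<open>Reachability and alternets\<close>

text \<open>The vertices of the walk are \<open>xs ! 0, \<dots>, xs ! n\<close> with \<open>n = length xs - 1\<close>.\<close>

definition alternating_walk :: "'a pair_pre_digraph \<Rightarrow> 'a list \<Rightarrow> bool" where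
  "alternating_walk D xs \<longleftrightarrow> xs \<noteq> [] \<and> set xs \<subseteq> pverts D \<and>
     ((\<forall>i. (0 < i \<and> 2 * i < length xs \<longrightarrow> (xs ! (2 * i - 1), xs ! (2 * i)) \<in> parcs D) \<and>
           (2 * i + 1 < length xs \<longrightarrow> (xs ! (2 * i + 1), xs ! (2 * i)) \<in> parcs D)) \<or>
      (\<forall>i. (0 < i \<and> 2 * i < length xs \<longrightarrow> (xs ! (2 * i), xs ! (2 * i - 1)) \<in> parcs D) \<and>
           (2 * i + 1 < length xs \<longrightarrow> (xs ! (2 * i), xs ! (2 * i + 1)) \<in> parcs D)))"

definition edge_reach :: "'a pair_pre_digraph \<Rightarrow> ('a \<times> 'a) rel" where
  "edge_reach D = {(e, e'). e \<in> parcs D \<and> e' \<in> parcs D \<and>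
     (\<exists>xs n. alternating_walk D xs \<and> length xs = n + 1 \<and> 1 \<le> n \<and> e = (xs ! 0, xs ! 1) \<and>
        e' \<in> {(xs ! (n - 1), xs ! n), (xs ! n, xs ! (n - 1))})}"

definition reachability_universal :: "'a pair_pre_digraph \<Rightarrow> bool" where
  "reachability_universal D \<longleftrightarrow> (\<exists>C. parcs D // edge_reach D = {C})"

definition spanned_by :: "('a \<times> 'a) set \<Rightarrow> 'a pair_pre_digraph" where
  "spanned_by C = \<lparr>pverts = fst ` C \<union> snd ` C, parcs = C\<rparr>"

definition alternets :: "'a pair_pre_digraph \<Rightarrow> 'a pair_pre_digraph set" where
  "alternets D = spanned_by ` (parcs D // edge_reach D)"

definition sources :: "'a pair_pre_digraph \<Rightarrow> 'a set" where
  "sources A = fst ` parcs A"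

section \<open>The relation delta and the class C\<close>

definition delta :: "'a pair_pre_digraph \<Rightarrow> 'a rel" where
  "delta D = {(u, v). u \<in> pverts D \<and> v \<in> pverts D \<and> parcs D `` {u} = parcs D `` {v}}"

definition delta_nontrivial_on :: "'a pair_pre_digraph \<Rightarrow> 'a set \<Rightarrow> bool" where
  "delta_nontrivial_on D X \<longleftrightarrow> (\<exists>u\<in>X. \<exists>v\<in>X. u \<noteq> v \<and> (u, v) \<in> delta D)"

definition delta_quotient :: "'a pair_pre_digraph \<Rightarrow> 'a set pair_pre_digraph" where
  "delta_quotient D = \<lparr>pverts = pverts D // delta D,
     parcs = {(A, B). A \<in> pverts D // delta D \<and> B \<in> pverts D // delta D \<and>
                      (\<exists>a\<in>A. \<exists>b\<in>B. (a, b) \<in> parcs D)}\<rparr>"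

definition class_C :: "'a pair_pre_digraph \<Rightarrow> bool" where
  "class_C G \<longleftrightarrow> (\<exists>X Y. pverts G = X \<union> Y \<and> X \<inter> Y = {} \<and> parcs G \<subseteq> X \<times> Y \<and>
     (\<forall>v\<in>pverts G. \<exists>w. (v, w) \<in> parcs G \<or> (w, v) \<in> parcs G) \<and>
     finite X \<and> X \<noteq> {} \<and> finite Y \<and> Y \<noteq> {} \<and>
     edge_transitive G \<and> delta_nontrivial_on G X \<and>
     (\<forall>x\<in>X. card {x'\<in>X. (x, x') \<in> delta G} = card Y))"

section \<open>The digraphs Sigma(m,M) and D(m,M)\<close>

text \<open>\<open>M = \<infinity>\<close> stands for \<open>\<aleph>\<^sub>0\<close>: the set \<open>\<Omega>\<close> is
  \<open>{0, \<dots>, M - 1}\<close> for finite \<open>M\<close> and the set of all natural numbers for \<open>M = \<infinity>\<close>.\<close>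

definition Omega :: "enat \<Rightarrow> nat set" where
  "Omega M = {i. enat i < M}"

definition m_subsets :: "nat \<Rightarrow> enat \<Rightarrow> nat set set" where
  "m_subsets m M = {s. s \<subseteq> Omega M \<and> finite s \<and> card s = m}"

definition Sigma_digraph :: "nat \<Rightarrow> enat \<Rightarrow> ((nat set \<times> nat) + nat) pair_pre_digraph" where
  "Sigma_digraph m M =
     \<lparr>pverts = Inl ` (m_subsets m M \<times> Omega M) \<union> Inr ` Omega M,
      parcs = {(Inl (s, c), Inr a) | s c a. s \<in> m_subsets m M \<and> c \<in> Omega M \<and> a \<in> s}\<rparr>"

text \<open>The tree has out-valency 1 and, through the bijections, in-valency \<open>|S|\<close>, which
  is infinite for \<open>M = \<infinity>\<close> (recall \<open>m \<ge> 1\<close>).\<close>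

definition labelled_regular_tree ::
    "nat \<Rightarrow> enat \<Rightarrow> 't pair_pre_digraph \<Rightarrow> ('t \<Rightarrow> 't \<Rightarrow> nat set) \<Rightarrow> bool" where
  "labelled_regular_tree m M T \<phi> \<longleftrightarrow> directed_tree T \<and> infinite (pverts T) \<and>
     has_out_valency T 1 \<and>
     (\<forall>t\<in>pverts T. bij_betw (\<phi> t) {t'. (t', t) \<in> parcs T} (m_subsets m M))"

definition D_digraph ::
    "enat \<Rightarrow> 't pair_pre_digraph \<Rightarrow> ('t \<Rightarrow> 't \<Rightarrow> nat set) \<Rightarrow> ('t \<times> nat) pair_pre_digraph" where
  "D_digraph M T \<phi> =
     \<lparr>pverts = pverts T \<times> Omega M,
      parcs = {((t', c), (t, a)) | t' t c a. (t', t) \<in> parcs T \<and> c \<in> Omega M \<and> a \<in> \<phi> t t'}\<rparr>"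

section \<open>Sanity checks\<close>

lemma digraph_iso_iff:
  assumes "pair_wf_digraph G" "pair_wf_digraph H"
  shows "digraph_iso (with_proj G) (with_proj H) \<longleftrightarrow>
    (\<exists>f. dg_isom f (with_proj G) (with_proj H))"
proof
  assume "digraph_iso (with_proj G) (with_proj H)"
  then obtain h where h: "pre_digraph.digraph_isomorphism (with_proj G) h"
    and H: "with_proj H = app_iso h (with_proj G)"
    unfolding digraph_iso_def by blast
  let ?f = "iso_verts h"
  have inj: "inj_on ?f (pverts G)" and
    ends: "\<forall>a\<in>parcs G. ?f (fst a) = iso_tail h (iso_arcs h a) \<and> ?f (snd a) = iso_head h (iso_arcs h a)"
    using h unfolding pre_digraph.digraph_isomorphism_def by auto
  have V: "pverts H = ?f ` pverts G" and A: "parcs H = iso_arcs h ` parcs G"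
    and t: "iso_tail h = fst" and hd: "iso_head h = snd"
    using H by (metis verts_app_iso with_proj_simps(1), metis arcs_app_iso with_proj_simps(2),
      metis tail_app_iso with_proj_simps(4), metis head_app_iso with_proj_simps(5))
  have "iso_arcs h a = (?f (fst a), ?f (snd a))" if "a \<in> parcs G" for a
    using ends that by (simp add: t hd)
  then have A': "parcs H = (\<lambda>a. (?f (fst a), ?f (snd a))) ` parcs G"
    unfolding A by (rule image_cong[OF refl])
  have "dg_isom ?f (with_proj G) (with_proj H)"
    unfolding dg_isom_def bij_betw_def with_proj_simps
  proof (intro conjI ballI)
    show "inj_on ?f (pverts G)" by (rule inj)
    show "?f ` pverts G = pverts H" by (simp add: V)
    fix u v assume uv: "u \<in> pverts G" "v \<in> pverts G"
    show "(u, v) \<in> parcs G \<longleftrightarrow> (?f u, ?f v) \<in> parcs H"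
    proof
      assume "(u, v) \<in> parcs G"
      then show "(?f u, ?f v) \<in> parcs H" unfolding A' by force
    next
      assume "(?f u, ?f v) \<in> parcs H"
      then obtain a where a: "a \<in> parcs G" "?f (fst a) = ?f u" "?f (snd a) = ?f v"
        unfolding A' by auto
      then have "fst a = u" "snd a = v"
        using inj uv a pair_wf_digraph.arc_fst_in_verts[OF assms(1) a(1)]
          pair_wf_digraph.arc_snd_in_verts[OF assms(1) a(1)] by (auto dest: inj_onD)
      then show "(u, v) \<in> parcs G" using a(1) by auto
    qed
  qed
  then show "\<exists>f. dg_isom f (with_proj G) (with_proj H)" by blast
next
  assume "\<exists>f. dg_isom f (with_proj G) (with_proj H)"
  then obtain f where f: "bij_betw f (pverts G) (pverts H)"
    and e: "\<And>u v. u \<in> pverts G \<Longrightarrow> v \<in> pverts G \<Longrightarrow> (u, v) \<in> parcs G \<longleftrightarrow> (f u, f v) \<in> parcs H"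
    unfolding dg_isom_def by auto
  let ?h = "\<lparr>iso_verts = f, iso_arcs = map_prod f f, iso_head = snd, iso_tail = fst\<rparr>"
  have inj: "inj_on f (pverts G)" and V: "f ` pverts G = pverts H"
    using f by (auto simp: bij_betw_def)
  have sub: "parcs G \<subseteq> pverts G \<times> pverts G" "parcs H \<subseteq> pverts H \<times> pverts H"
    using assms unfolding pair_wf_digraph_def by (metis mem_Times_iff subsetI)+
  have A: "map_prod f f ` parcs G = parcs H"
  proof
    show "map_prod f f ` parcs G \<subseteq> parcs H" using sub e by auto
    show "parcs H \<subseteq> map_prod f f ` parcs G"
    proof
      fix p assume p: "p \<in> parcs H"
      then obtain u v where "u \<in> pverts G" "v \<in> pverts G" "p = (f u, f v)"
        using sub(2) unfolding V[symmetric] by auto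
      with e p have "(u, v) \<in> parcs G" by simp
      then show "p \<in> map_prod f f ` parcs G" using \<open>p = (f u, f v)\<close> by (metis map_prod_imageI)
    qed
  qed
  have "inj_on (map_prod f f) (parcs G)"
    by (rule inj_on_subset[OF map_prod_inj_on[OF inj inj] sub(1)])
  moreover have "wf_digraph (with_proj G)"
    using assms(1) by (simp add: wf_digraph_def pair_wf_digraph_def)
  ultimately have "pre_digraph.digraph_isomorphism (with_proj G) ?h"
    using inj unfolding pre_digraph.digraph_isomorphism_def by auto
  moreover have "with_proj H = app_iso ?h (with_proj G)"
    unfolding app_iso_def with_proj_def by (simp add: V A)
  ultimately show "digraph_iso (with_proj G) (with_proj H)"
    unfolding digraph_iso_def by blast
qed

text \<open>The tree and the bijections required by \<open>labelled_regular_tree\<close> exist. A vertex is a level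
  together with the labels read along its out-going ray.\<close>

lemma labelled_regular_tree_exists:
  assumes "enat m \<le> M"
  shows "\<exists>(T :: (int \<times> (int \<Rightarrow> nat set)) pair_pre_digraph) \<phi>. labelled_regular_tree m M T \<phi>"
proof -
  let ?S = "m_subsets m M"
  define s0 where "s0 = {..<m}"
  have "enat i < M" if "i < m" for i
    using assms that by (metis enat_ord_simps(2) less_le_trans)
  then have s0: "s0 \<in> ?S"
    unfolding s0_def m_subsets_def Omega_def by auto
  define V :: "(int \<times> (int \<Rightarrow> nat set)) set" where
    "V = {(k, f). range f \<subseteq> ?S \<and> (\<forall>j<k. f j = s0) \<and> finite {j. f j \<noteq> s0}}"
  define up :: "int \<times> (int \<Rightarrow> nat set) \<Rightarrow> int \<times> (int \<Rightarrow> nat set)" where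
    "up = (\<lambda>(k, f). (k + 1, f(k := s0)))"
  define T where "T = \<lparr>pverts = V, parcs = (\<lambda>x. (x, up x)) ` V\<rparr>"
  define \<phi> :: "int \<times> (int \<Rightarrow> nat set) \<Rightarrow> int \<times> (int \<Rightarrow> nat set) \<Rightarrow> nat set" where
    "\<phi> = (\<lambda>t t'. snd t' (fst t'))"
  have upd: "(k', f(j := s)) \<in> V"
    if "(k, f) \<in> V" "s \<in> ?S" "k' \<le> k + 1" "k' > j \<longrightarrow> s = s0" "k' \<le> k \<or> j = k" for k k' f j s
  proof -
    have "{i. (f(j := s)) i \<noteq> s0} \<subseteq> insert j {i. f i \<noteq> s0}" by auto
    moreover have "finite (insert j {i. f i \<noteq> s0})" using that(1) unfolding V_def by simp
    ultimately have "finite {i. (f(j := s)) i \<noteq> s0}" by (rule finite_subset)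
    moreover have "\<forall>i<k'. (f(j := s)) i = s0" using that unfolding V_def by auto
    moreover have "(f(j := s)) i \<in> ?S" for i using that(1,2) unfolding V_def by auto
    then have "range (f(j := s)) \<subseteq> ?S" by blast
    ultimately show ?thesis unfolding V_def by (simp only: mem_Collect_eq prod.case simp_thms)
  qed
  have up_V: "up x \<in> V" if "x \<in> V" for x
    using that s0 upd[of "fst x" "snd x" s0 "fst x + 1" "fst x"] by (cases x) (simp add: up_def)
  have fst_up: "fst (up x) = fst x + 1" for x
    by (cases x) (simp add: up_def)
  have E: "(x, y) \<in> parcs T \<longleftrightarrow> x \<in> V \<and> y = up x" for x y
    unfolding T_def by auto
  have VT: "pverts T = V" unfolding T_def by simp
  interpret T: pair_loopfree_digraph T
  proof
    fix e assume "e \<in> parcs T"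
    then obtain x where "x \<in> V" "e = (x, up x)" unfolding T_def by auto
    then show "fst e \<in> pverts T" "snd e \<in> pverts T" "fst e \<noteq> snd e"
      using up_V fst_up[of x] by (auto simp: VT)
  qed
  have sym: "(x, y) \<in> parcs (mk_symmetric (with_proj T)) \<longleftrightarrow> (x, y) \<in> parcs T \<or> (y, x) \<in> parcs T" for x y
    by (cases x, cases y) (auto simp: parcs_mk_symmetric Bex_def)
  have ray_V: "(up ^^ n) x \<in> V" if "x \<in> V" for n x
    by (induction n) (auto simp: that up_V)
  have ray: "x \<rightarrow>\<^sup>*\<^bsub>with_proj T\<^esub> (up ^^ n) x" if "x \<in> V" for n x
  proof (induction n)
    case 0
    then show ?case using that by (simp add: VT)
  next
    case (Suc n)
    have "((up ^^ n) x, (up ^^ Suc n) x) \<in> parcs T" using ray_V[OF that] by (simp add: E)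
    with Suc show ?case by (rule T.reachable_adj_trans)
  qed
  have ray_eq: "(up ^^ n) (k, f) = (k + int n, \<lambda>j. if k \<le> j \<and> j < k + int n then s0 else f j)" for n k f
    by (induction n) (auto simp: up_def fun_eq_iff)
  have base: "\<exists>n. \<forall>n'\<ge>n. (up ^^ n') (k, f) = (k + int n', \<lambda>_. s0)" if "(k, f) \<in> V" for k f
  proof -
    have fin: "finite {j. f j \<noteq> s0}" and low: "\<forall>j<k. f j = s0" using that unfolding V_def by auto
    obtain b where b: "\<forall>j\<in>{j. f j \<noteq> s0}. j \<le> b" using fin bdd_above_finite bdd_above_def by metis
    have "(up ^^ n') (k, f) = (k + int n', \<lambda>_. s0)" if "n' \<ge> nat (b + 1 - k)" for n'
      unfolding ray_eq using b low that by (auto simp: fun_eq_iff)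
    then show ?thesis by blast
  qed
  interpret S: pair_wf_digraph "mk_symmetric (with_proj T)" ..
  have conn: "connected (with_proj T)"
    unfolding connected_def strongly_connected_def
  proof (intro conjI ballI)
    have "(0, \<lambda>_. s0) \<in> V" using s0 unfolding V_def by auto
    then show "verts (with_proj (mk_symmetric (with_proj T))) \<noteq> {}" by (auto simp: VT)
    fix x y assume "x \<in> verts (with_proj (mk_symmetric (with_proj T)))"
      "y \<in> verts (with_proj (mk_symmetric (with_proj T)))"
    then have xy: "x \<in> V" "y \<in> V" by (auto simp: VT)
    obtain k f l g where xe: "x = (k, f)" and ye: "y = (l, g)" by (cases x, cases y)
    obtain a b where a: "\<forall>n\<ge>a. (up ^^ n) (k, f) = (k + int n, \<lambda>_. s0)"
      and b: "\<forall>n\<ge>b. (up ^^ n) (l, g) = (l + int n, \<lambda>_. s0)"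
      using base xy xe ye by metis
    define c where "c = max (k + int a) (l + int b)"
    have "(up ^^ nat (c - k)) x = (c, \<lambda>_. s0)" "(up ^^ nat (c - l)) y = (c, \<lambda>_. s0)"
      using a[rule_format, of "nat (c - k)"] b[rule_format, of "nat (c - l)"]
      unfolding xe ye c_def by (auto simp: nat_le_iff le_nat_iff)
    then have "x \<rightarrow>\<^sup>*\<^bsub>with_proj (mk_symmetric (with_proj T))\<^esub> (c, \<lambda>_. s0)"
      "y \<rightarrow>\<^sup>*\<^bsub>with_proj (mk_symmetric (with_proj T))\<^esub> (c, \<lambda>_. s0)"
      using ray xy T.reachable_mk_symmetricI by metis+
    moreover have "symmetric (with_proj (mk_symmetric (with_proj T)))"
      by (rule symmetric_mk_symmetric)
    ultimately show "x \<rightarrow>\<^sup>*\<^bsub>with_proj (mk_symmetric (with_proj T))\<^esub> y"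
      by (blast intro: S.reachable_trans symmetric_reachable)
  qed
  have nocyc: False if c: "undirected_cycle T xs" for xs
  proof -
    let ?n = "length xs"
    have n: "3 \<le> ?n" and d: "distinct xs"
      and adj: "\<And>i. i < ?n \<Longrightarrow> (xs ! i, xs ! ((i + 1) mod ?n)) \<in> parcs (mk_symmetric (with_proj T))"
      using c unfolding undirected_cycle_def by auto
    define i where "i = arg_min_on (\<lambda>i. fst (xs ! i)) {..<?n}"
    have i: "i < ?n" "\<And>j. j < ?n \<Longrightarrow> fst (xs ! i) \<le> fst (xs ! j)"
    proof -
      have ne: "{..<?n} \<noteq> {}" "finite {..<?n}" using n by (auto simp: lessThan_empty_iff)
      show "i < ?n" using arg_min_if_finite(1)[OF ne(2,1)] unfolding i_def by blast
      show "fst (xs ! i) \<le> fst (xs ! j)" if "j < ?n" for j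
        unfolding i_def by (rule arg_min_least[OF ne(2,1)]) (simp add: that)
    qed
    define p where "p = (if i = 0 then ?n - 1 else i - 1)"
    define q where "q = (i + 1) mod ?n"
    have p: "p < ?n" "(p + 1) mod ?n = i" using i(1) n unfolding p_def by auto
    have q: "q < ?n" using i(1) unfolding q_def by (metis i(1) mod_less_divisor not_less_zero neq0_conv)
    have pq: "p \<noteq> q"
    proof (cases "i + 1 < ?n")
      case True
      then show ?thesis using n i(1) unfolding p_def q_def by auto
    next
      case False
      then have "i + 1 = ?n" using i(1) by simp
      then show ?thesis using n unfolding p_def q_def by auto
    qed
    have "xs ! q = up (xs ! i)"
      using adj[OF i(1)] i(2)[OF q] fst_up[of "xs ! q"] unfolding sym E q_def by auto
    moreover have "xs ! p = up (xs ! i)"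
      using adj[OF p(1)] i(2)[OF p(1)] fst_up[of "xs ! p"] unfolding sym E p(2) by auto
    ultimately show False using d p(1) q pq by (metis nth_eq_iff_index_eq)
  qed
  have tree: "directed_tree T"
    unfolding directed_tree_def
  proof (intro conjI allI impI notI)
    show "pair_loopfree_digraph T" by unfold_locales
    show "connected (with_proj T)" by (rule conn)
    show "False" if "(u, v) \<in> parcs T" "(v, u) \<in> parcs T" for u v
      using that fst_up[of u] fst_up[of v] by (auto simp: E)
    show "False" if "\<exists>xs. undirected_cycle T xs" using that nocyc by blast
  qed
  have inf: "infinite V"
  proof
    assume "finite V"
    moreover have "range (\<lambda>k::int. (k, \<lambda>_::int. s0)) \<subseteq> V" using s0 unfolding V_def by auto
    moreover have "inj (\<lambda>k::int. (k, \<lambda>_::int. s0))" by (auto intro: injI)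
    ultimately show False by (metis finite_imageD finite_subset infinite_UNIV_int)
  qed
  have out: "has_out_valency T 1"
    unfolding has_out_valency_def out_degree_def
  proof (intro ballI)
    fix v assume "v \<in> pverts T"
    then have "out_arcs (with_proj T) v = {(v, up v)}"
      unfolding out_arcs_def by (auto simp: E VT)
    then show "finite (out_arcs (with_proj T) v) \<and> card (out_arcs (with_proj T) v) = 1" by simp
  qed
  have bij: "bij_betw (\<phi> t) {t'. (t', t) \<in> parcs T} ?S" if "t \<in> pverts T" for t
  proof -
    obtain k g where t: "t = (k, g)" by (cases t)
    have tV: "(k, g) \<in> V" using that t VT by simp
    then have g0: "g (k - 1) = s0" unfolding V_def by auto
    have nb: "{t'. (t', t) \<in> parcs T} = (\<lambda>s. (k - 1, g(k - 1 := s))) ` ?S"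
    proof (intro equalityI subsetI)
      fix t' assume "t' \<in> {t'. (t', t) \<in> parcs T}"
      then have t': "t' \<in> V" "t = up t'" by (auto simp: E)
      obtain l f where lf: "t' = (l, f)" by (cases t')
      have l: "l = k - 1" and "g = f(k - 1 := s0)" using t'(2) unfolding lf t up_def by auto
      then have "f = g(k - 1 := f (k - 1))" by auto
      moreover have "f (k - 1) \<in> ?S" using t'(1) unfolding lf V_def by auto
      ultimately show "t' \<in> (\<lambda>s. (k - 1, g(k - 1 := s))) ` ?S" unfolding lf l by blast
    next
      fix t' assume "t' \<in> (\<lambda>s. (k - 1, g(k - 1 := s))) ` ?S"
      then obtain s where s: "s \<in> ?S" "t' = (k - 1, g(k - 1 := s))" by auto
      have "t' \<in> V" unfolding s(2) by (rule upd[OF tV s(1)]) auto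
      moreover have "up t' = t" unfolding s(2) up_def t using g0 by auto
      ultimately show "t' \<in> {t'. (t', t) \<in> parcs T}" by (simp add: E)
    qed
    show ?thesis unfolding nb bij_betw_def \<phi>_def by (auto simp: inj_on_def image_image)
  qed
  have "labelled_regular_tree m M T \<phi>"
    unfolding labelled_regular_tree_def using tree inf out bij VT by blast
  then show ?thesis by blast
qed

end

theory Submission
  imports Defs
begin

text \<open>Call two vertices cosinks if they are heads of edges in the same reachability class. If
  \<open>x\<close> and \<open>x'\<close> have the same out-neighbours and neither is a descendant of \<open>w\<close>, then moving \<open>x\<close> to
  \<open>x'\<close> and fixing everything else is an isomorphism from the descendants of \<open>{x, w}\<close> to those of
  \<open>{x', w}\<close>, so some automorphism fixes \<open>w\<close> and maps \<open>x\<close> to \<open>x'\<close>. Choosing \<open>w\<close> to be a cosink of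
  \<open>x\<close>, this shows that delta-equivalent vertices are cosinks. The converse follows by counting if the alternets are
  in the class C, and from the fact that all \<open>m\<close>-sets of sinks are out-neighbourhoods if they are copies
  of Sigma(m,M). When delta-classes are exactly the sink sets of alternets, each delta-class has a single
  out-neighbour in the quotient, which is therefore a tree.

  For the isomorphism with D(m,M), the labellings of two such trees need not agree along any ray, but permuting
  \<open>\<Omega>\<close> at each tree vertex makes the labels constant along one ray of each tree. After
  that, a vertex is determined by the labels read on its way up to that ray.\<close>

section \<open>Automorphisms and the relation delta\<close>

text \<open>The choice of \<open>w\<close> is the delicate point, since a cosink of \<open>x\<close>
  may have vertices of the delta-class of \<open>x\<close> among its descendants. As long as no two
  distinct delta-equivalent vertices are cosinks, every cosink of \<open>x\<close> other than
  \<open>x\<close> must even have such descendants, for otherwise the exchange would produce a pair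
  of this kind. Two out-neighbours \<open>a\<close>, \<open>b\<close> of one vertex, which exist
  because \<open>m > 1\<close>, then reach each other's delta-classes; as delta-equivalent vertices
  have the same proper descendants, \<open>a\<close> reaches its own class and a directed cycle
  arises. So one pair exists. Vertex transitivity puts a copy of it at every \<open>y\<close>, and
  from then on \<open>w = y\<close> is always admissible, because no vertex properly reaches its own
  delta-class.

  In the class C the size of delta-classes is prescribed on sources, whereas delta and cosinks are
  compared on sinks; vertex transitivity links the two.

  Acyclicity also simplifies the notions: s-arcs become walks, and alternating walks become chains
  of edges in which neighbours share a tail or a head.\<close>

lemma automorphism_iff:
  "automorphism D g \<longleftrightarrow> bij_betw g (pverts D) (pverts D) \<and>
     (\<forall>u\<in>pverts D. \<forall>v\<in>pverts D. (u, v) \<in> parcs D \<longleftrightarrow> (g u, g v) \<in> parcs D)"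
  by (simp add: automorphism_def dg_isom_def)

lemma (in pair_wf_digraph) parcs_in_pverts:
  assumes "(u, v) \<in> parcs G"
  shows "u \<in> pverts G" "v \<in> pverts G"
  using in_arcsD1[OF assms] in_arcsD2[OF assms] .

lemma (in pair_wf_digraph) automorphism_out_neighbours:
  assumes "automorphism G g" "u \<in> pverts G"
  shows "parcs G `` {g u} = g ` (parcs G `` {u})"
proof -
  have g: "bij_betw g (pverts G) (pverts G)"
    and e: "\<And>u v. u \<in> pverts G \<Longrightarrow> v \<in> pverts G \<Longrightarrow> (u, v) \<in> parcs G \<longleftrightarrow> (g u, g v) \<in> parcs G"
    using assms(1) unfolding automorphism_iff by auto
  show ?thesis
  proof (intro equalityI subsetI)
    fix w assume w: "w \<in> parcs G `` {g u}"
    then have "w \<in> pverts G" using parcs_in_pverts by auto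
    then obtain v where "v \<in> pverts G" "w = g v" using g by (auto simp: bij_betw_def)
    then show "w \<in> g ` (parcs G `` {u})" using w e[OF assms(2)] by auto
  next
    fix w assume "w \<in> g ` (parcs G `` {u})"
    then obtain v where v: "(u, v) \<in> parcs G" "w = g v" by auto
    then show "w \<in> parcs G `` {g u}" using e[OF assms(2) parcs_in_pverts(2)[OF v(1)]] by simp
  qed
qed

lemma (in pair_wf_digraph) automorphism_delta_iff:
  assumes "automorphism G g" "u \<in> pverts G" "v \<in> pverts G"
  shows "(g u, g v) \<in> delta G \<longleftrightarrow> (u, v) \<in> delta G"
proof -
  have g: "bij_betw g (pverts G) (pverts G)" using assms(1) unfolding automorphism_iff by auto
  have sub: "parcs G `` {x} \<subseteq> pverts G" for x using parcs_in_pverts by auto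
  have "g ` (parcs G `` {u}) = g ` (parcs G `` {v}) \<longleftrightarrow> parcs G `` {u} = parcs G `` {v}"
    by (rule inj_on_image_eq_iff[OF bij_betw_imp_inj_on[OF g] sub sub])
  moreover have "g u \<in> pverts G" "g v \<in> pverts G" using g assms(2,3) by (auto simp: bij_betw_def)
  ultimately show ?thesis
    unfolding delta_def using automorphism_out_neighbours[OF assms(1)] assms(2,3) by simp
qed

lemma (in pair_wf_digraph) automorphism_delta_class:
  assumes "automorphism G g" "u \<in> pverts G"
  shows "delta G `` {g u} = g ` (delta G `` {u})"
proof -
  have g: "bij_betw g (pverts G) (pverts G)" using assms(1) unfolding automorphism_iff by auto
  have V: "(x, y) \<in> delta G \<Longrightarrow> y \<in> pverts G" for x y by (auto simp: delta_def)
  show ?thesis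
  proof (intro equalityI subsetI)
    fix w assume w: "w \<in> delta G `` {g u}"
    then have "w \<in> g ` pverts G" using g V by (auto simp: bij_betw_def)
    then obtain v where "v \<in> pverts G" "w = g v" by blast
    then show "w \<in> g ` (delta G `` {u})" using w automorphism_delta_iff[OF assms] by auto
  next
    fix w assume "w \<in> g ` (delta G `` {u})"
    then obtain v where v: "(u, v) \<in> delta G" "w = g v" by auto
    then show "w \<in> delta G `` {g u}" using automorphism_delta_iff[OF assms V[OF v(1)]] by simp
  qed
qed

lemma equiv_delta: "equiv (pverts D) (delta D)"
  by (intro equivI) (auto simp: delta_def refl_on_def sym_def trans_def)

text \<open>The start vertex of a path matters only through the first arc, and that arc can be
  replaced.\<close>

lemma delta_imp_same_trancl:
  assumes "(u, v) \<in> delta D"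
  shows "(parcs D)\<^sup>+ `` {u} = (parcs D)\<^sup>+ `` {v}"
proof -
  have "(x, z) \<in> (parcs D)\<^sup>+ \<Longrightarrow> (x, y) \<in> delta D \<Longrightarrow> (y, z) \<in> (parcs D)\<^sup>+" for x y z
  proof -
    assume xz: "(x, z) \<in> (parcs D)\<^sup>+" and xy: "(x, y) \<in> delta D"
    obtain w where w: "(x, w) \<in> parcs D" "(w, z) \<in> (parcs D)\<^sup>*" using xz by (meson tranclD)
    have "(y, w) \<in> parcs D" using xy w(1) unfolding delta_def by blast
    then show "(y, z) \<in> (parcs D)\<^sup>+" using w(2) by (rule rtrancl_into_trancl2)
  qed
  moreover have "(v, u) \<in> delta D" using assms by (auto simp: delta_def)
  ultimately show ?thesis using assms by blast
qed

section \<open>Reachability of edges\<close>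

text \<open>One step of reachability. In an acyclic digraph \<open>edge_reach\<close> is the
  transitive closure of this relation, from which the equivalence properties and the invariance
  under automorphisms are read off without handling walks.\<close>

definition coincident :: "'a pair_pre_digraph \<Rightarrow> ('a \<times> 'a) rel" where
  "coincident D = {(e, e'). e \<in> parcs D \<and> e' \<in> parcs D \<and> (fst e = fst e' \<or> snd e = snd e')}"

text \<open>The second of the two forms in \<open>alternating_walk\<close>, the one that begins with
  a forward arc. With a function in place of a list, extending a walk is a function update.\<close>

definition zigzag :: "'a pair_pre_digraph \<Rightarrow> (nat \<Rightarrow> 'a) \<Rightarrow> nat \<Rightarrow> bool" where
  "zigzag D f n \<longleftrightarrow> (\<forall>k<n. (if even k then (f k, f (Suc k)) else (f (Suc k), f k)) \<in> parcs D)"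

lemma zigzag_append:
  assumes "zigzag D f n" "(if even n then (f n, x) else (x, f n)) \<in> parcs D"
  shows "zigzag D (f(Suc n := x)) (Suc n)"
  using assms unfolding zigzag_def by (auto simp: less_Suc_eq)

context pair_wf_digraph
begin

lemma zigzag_alternating_walk:
  assumes z: "zigzag G f n" and n: "1 \<le> n"
  shows "alternating_walk G (map f [0..<Suc n])"
proof -
  let ?xs = "map f [0..<Suc n]"
  have nth: "?xs ! k = f k" if "k < Suc n" for k using that by (metis diff_zero length_upt nth_map nth_upt add_0)
  have "f k \<in> pverts G" if "k \<le> n" for k
  proof (cases "k = n")
    case True
    then show ?thesis using z n parcs_in_pverts unfolding zigzag_def
      by (metis Suc_diff_le diff_Suc_1 le_add_diff_inverse less_eq_Suc_le plus_1_eq_Suc order_refl One_nat_def)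
  next
    case False
    then show ?thesis using z that parcs_in_pverts unfolding zigzag_def by (metis le_neq_implies_less)
  qed
  then have "set ?xs \<subseteq> pverts G" by auto
  moreover have "(?xs ! (2 * i), ?xs ! (2 * i - 1)) \<in> parcs G" if "0 < i" "2 * i < length ?xs" for i
  proof -
    have "2 * i - 1 < n" "odd (2 * i - 1)" "Suc (2 * i - 1) = 2 * i" using that by auto
    then show ?thesis using z nth unfolding zigzag_def by (metis less_SucI Suc_less_eq)
  qed
  moreover have "(?xs ! (2 * i), ?xs ! (2 * i + 1)) \<in> parcs G" if "2 * i + 1 < length ?xs" for i
    using that z nth[of "2 * i"] nth[of "2 * i + 1"] unfolding zigzag_def by auto
  ultimately show ?thesis unfolding alternating_walk_def by auto
qed

text \<open>The other form of an alternating walk would make \<open>(xs ! 1, xs ! 0)\<close> an arc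
  as well, which gives a directed 2-cycle.\<close>

lemma alternating_walk_zigzag:
  assumes w: "alternating_walk G xs" and len: "length xs = n + 1" and n: "1 \<le> n"
    and e: "(xs ! 0, xs ! 1) \<in> parcs G" and acyc: "acyclic (parcs G)"
  shows "zigzag G ((!) xs) n"
proof -
  have "(xs ! 1, xs ! 0) \<notin> parcs G" using e acyc unfolding acyclic_def by (meson trancl.simps)
  then have h: "\<And>i. 0 < i \<and> 2 * i < length xs \<Longrightarrow> (xs ! (2 * i), xs ! (2 * i - 1)) \<in> parcs G"
    "\<And>i. 2 * i + 1 < length xs \<Longrightarrow> (xs ! (2 * i), xs ! (2 * i + 1)) \<in> parcs G"
    using w len n unfolding alternating_walk_def
    by (metis Suc_eq_plus1 add_0 less_Suc_eq_le mult_0_right)+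
  show ?thesis unfolding zigzag_def
  proof (intro allI impI)
    fix k assume k: "k < n"
    show "(if even k then (xs ! k, xs ! Suc k) else (xs ! Suc k, xs ! k)) \<in> parcs G"
    proof (cases "even k")
      case True
      then show ?thesis using h(2)[of "k div 2"] k len by auto
    next
      case False
      then have "2 * ((k + 1) div 2) = k + 1" by auto
      then show ?thesis using h(1)[of "(k + 1) div 2"] k len False by (auto simp del: even_Suc)
    qed
  qed
qed

lemma edge_reach_eq_trancl:
  assumes acyc: "acyclic (parcs G)"
  shows "edge_reach G = (coincident G)\<^sup>+"
proof (intro equalityI subrelI)
  fix e e' assume "(e, e') \<in> edge_reach G"
  then obtain xs n where e: "e \<in> parcs G" "e' \<in> parcs G" and w: "alternating_walk G xs"
    and n: "length xs = n + 1" "1 \<le> n" "e = (xs ! 0, xs ! 1)"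
    and e': "e' \<in> {(xs ! (n - 1), xs ! n), (xs ! n, xs ! (n - 1))}"
    unfolding edge_reach_def by blast
  define arc where "arc k = (if even k then (xs ! k, xs ! Suc k) else (xs ! Suc k, xs ! k))" for k
  have z: "\<And>k. k < n \<Longrightarrow> arc k \<in> parcs G"
    using alternating_walk_zigzag[OF w n(1,2) _ acyc] e(1) n(3) unfolding zigzag_def arc_def by blast
  have "(e, arc k) \<in> (coincident G)\<^sup>+" if "k < n" for k
    using that
  proof (induction k)
    case 0
    then show ?case using e(1) n(3) by (auto simp: arc_def coincident_def)
  next
    case (Suc k)
    have "fst (arc k) = fst (arc (Suc k)) \<or> snd (arc k) = snd (arc (Suc k))" by (auto simp: arc_def)
    then have "(arc k, arc (Suc k)) \<in> coincident G" using z Suc.prems by (simp add: coincident_def)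
    then show ?case using Suc by (meson Suc_lessD trancl.trancl_into_trancl)
  qed
  \<comment> \<open>The definition of \<open>edge_reach\<close> admits the last pair in either
    order; the wrong order would give two opposite arcs.\<close>
  moreover have "e' = arc (n - 1)"
  proof (rule ccontr)
    assume "e' \<noteq> arc (n - 1)"
    moreover have "Suc (n - 1) = n" using n(2) by simp
    ultimately have "arc (n - 1) = (snd e', fst e')"
      using e' by (auto simp: arc_def split: if_splits)
    moreover have "arc (n - 1) \<in> parcs G" using z n(2) by simp
    ultimately have "(fst e', fst e') \<in> (parcs G)\<^sup>+" using e(2) by (metis prod.collapse trancl.simps)
    then show False using acyc unfolding acyclic_def by blast
  qed
  ultimately show "(e, e') \<in> (coincident G)\<^sup>+" using n(2) by simp
next
  fix e e' assume ee': "(e, e') \<in> (coincident G)\<^sup>+"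
  have eG: "e \<in> parcs G" using ee' by (induction rule: trancl_induct) (auto simp: coincident_def)
  define P where "P = (\<lambda>e'. \<exists>f n. zigzag G f (Suc n) \<and> e = (f 0, f 1) \<and>
      e' = (if even n then (f n, f (Suc n)) else (f (Suc n), f n)))"
  have step: "P y" if P: "P x" and xy: "(x, y) \<in> coincident G" for x y
  proof -
    obtain f n where f: "zigzag G f (Suc n)" "e = (f 0, f 1)"
      and x: "x = (if even n then (f n, f (Suc n)) else (f (Suc n), f n))" using P unfolding P_def by blast
    define a where "a = (if even n then fst y else snd y)"
    define b where "b = (if even n then snd y else fst y)"
    have y: "y = (if even n then (a, b) else (b, a))" by (simp add: a_def b_def)
    have arcs: "x \<in> parcs G" "y \<in> parcs G" and share: "f n = a \<or> f (Suc n) = b"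
      using xy by (auto simp: coincident_def a_def b_def x split: if_splits)
    \<comment> \<open>The new arc shares either the last vertex of the walk or the last but one. In
      the second case the walk first goes back over its last arc, which restores the parity, and
      then takes the new arc.\<close>
    consider "f (Suc n) = b" | "f n = a" using share by blast
    then show ?thesis
    proof cases
      case 1
      define h where "h = f(Suc (Suc n) := a)"
      have "zigzag G h (Suc (Suc n))" unfolding h_def
        by (rule zigzag_append[OF f(1)]) (use arcs 1 in \<open>auto simp: y split: if_splits\<close>)
      moreover have "e = (h 0, h 1)" "y = (if even (Suc n) then (h (Suc n), h (Suc (Suc n))) else (h (Suc (Suc n)), h (Suc n)))"
        using f(2) 1 by (auto simp: h_def y)
      ultimately show ?thesis unfolding P_def by blast
    next
      case 2
      define h where "h = f(Suc (Suc n) := f n)"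
      have h: "zigzag G h (Suc (Suc n))" unfolding h_def
        by (rule zigzag_append[OF f(1)]) (use arcs in \<open>auto simp: x split: if_splits\<close>)
      define h' where "h' = h(Suc (Suc (Suc n)) := b)"
      have "zigzag G h' (Suc (Suc (Suc n)))" unfolding h'_def
        by (rule zigzag_append[OF h]) (use arcs 2 in \<open>auto simp: y h_def split: if_splits\<close>)
      moreover have "e = (h' 0, h' 1)" "y = (if even (Suc (Suc n)) then (h' (Suc (Suc n)), h' (Suc (Suc (Suc n))))
          else (h' (Suc (Suc (Suc n))), h' (Suc (Suc n))))"
        using f(2) 2 by (auto simp: h'_def h_def y)
      ultimately show ?thesis unfolding P_def by blast
    qed
  qed
  have base: "P e" unfolding P_def
  proof (intro exI conjI)
    show "zigzag G (\<lambda>k. if k = 0 then fst e else snd e) (Suc 0)" using eG by (simp add: zigzag_def)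
  qed auto
  have "P e'" using ee' by (induction rule: trancl_induct) (use base step in blast)+
  then obtain f n where f: "zigzag G f (Suc n)" "e = (f 0, f 1)"
      and x: "e' = (if even n then (f n, f (Suc n)) else (f (Suc n), f n))" unfolding P_def by blast
  let ?xs = "map f [0..<Suc (Suc n)]"
  have nth: "?xs ! k = f k" if "k < Suc (Suc n)" for k using that by (metis diff_zero length_upt nth_map nth_upt add_0)
  have "e' \<in> parcs G" using f(1) x unfolding zigzag_def by blast
  moreover have "alternating_walk G ?xs" by (rule zigzag_alternating_walk[OF f(1)]) simp
  moreover have "length ?xs = Suc n + 1" by simp
  moreover have "e = (?xs ! 0, ?xs ! 1)" using f(2) nth[of 0] nth[of 1] by simp
  moreover have "e' \<in> {(?xs ! (Suc n - 1), ?xs ! (Suc n)), (?xs ! (Suc n), ?xs ! (Suc n - 1))}"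
    using x nth[of n] nth[of "Suc n"] by auto
  ultimately show "(e, e') \<in> edge_reach G"
    unfolding edge_reach_def using eG
    by (intro CollectI case_prodI conjI exI[of _ ?xs] exI[of _ "Suc n"]) auto
qed

lemma automorphism_edge_reach:
  assumes "acyclic (parcs G)" "automorphism G g" "(e, e') \<in> edge_reach G"
  shows "(map_prod g g e, map_prod g g e') \<in> edge_reach G"
proof -
  have c: "(map_prod g g x, map_prod g g y) \<in> coincident G" if "(x, y) \<in> coincident G" for x y
  proof -
    have "map_prod g g a \<in> parcs G" if "a \<in> parcs G" for a
      using that parcs_in_pverts[of "fst a" "snd a"] assms(2)
      unfolding automorphism_iff by (cases a) simp
    then show ?thesis using that unfolding coincident_def by (auto simp: fst_map_prod snd_map_prod)
  qed
  have "(e, e') \<in> (coincident G)\<^sup>+" using assms(1,3) edge_reach_eq_trancl by blast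
  then have "(map_prod g g e, map_prod g g e') \<in> (coincident G)\<^sup>+"
  proof (induction rule: trancl_induct)
    case (base y)
    then show ?case using c by blast
  next
    case (step y z)
    then show ?case using c by (meson trancl.trancl_into_trancl)
  qed
  then show ?thesis using edge_reach_eq_trancl[OF assms(1)] by simp
qed

lemma equiv_edge_reach:
  assumes "acyclic (parcs G)"
  shows "equiv (parcs G) (edge_reach G)"
proof -
  have "coincident G \<subseteq> parcs G \<times> parcs G" "sym (coincident G)" "Id_on (parcs G) \<subseteq> coincident G"
    by (auto simp: coincident_def sym_def)
  then show ?thesis unfolding edge_reach_eq_trancl[OF assms]
    by (intro equivI) (auto simp: refl_on_def intro: sym_trancl dest: trancl_subset_Sigma)
qed

lemma coincident_edge_reach:
  assumes "acyclic (parcs G)" "e \<in> parcs G" "e' \<in> parcs G" "fst e = fst e' \<or> snd e = snd e'"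
  shows "(e, e') \<in> edge_reach G"
  using assms(2-4) unfolding edge_reach_eq_trancl[OF assms(1)] by (auto simp: coincident_def)

section \<open>Descendants\<close>

text \<open>The non-backtracking condition on s-arcs holds for every walk, because backtracking
  would be a directed 2-cycle.\<close>

lemma desc_eq_rtrancl:
  assumes acyc: "acyclic (parcs G)" and u: "u \<in> pverts G"
  shows "desc G u = (parcs G)\<^sup>* `` {u}"
proof (intro equalityI subsetI)
  fix v assume "v \<in> desc G u"
  then obtain s xs where "s_arc G s u v xs" unfolding desc_def desc_at_def by auto
  then have "(u, v) \<in> (parcs G) ^^ s"
    unfolding s_arc_def relpow_fun_conv by (intro exI[of _ "(!) xs"]) auto
  then show "v \<in> (parcs G)\<^sup>* `` {u}" using relpow_imp_rtrancl by fast
next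
  fix v assume "v \<in> (parcs G)\<^sup>* `` {u}"
  then obtain s f where f: "f 0 = u" "f s = v" "\<And>i. i < s \<Longrightarrow> (f i, f (Suc i)) \<in> parcs G"
    by (metis Image_singleton_iff relpow_fun_conv rtrancl_imp_relpow)
  let ?xs = "map f [0..<Suc s]"
  have nth: "?xs ! k = f k" if "k < Suc s" for k using that by (metis diff_zero length_upt nth_map nth_upt add_0)
  have V: "f k \<in> pverts G" if "k \<le> s" for k
    using that f u parcs_in_pverts by (metis Suc_le_eq not0_implies_Suc)
  have "f (i - 1) \<noteq> f (i + 1)" if "0 < i" "i < s" for i
  proof
    assume eq: "f (i - 1) = f (i + 1)"
    have "(f (i - 1), f i) \<in> parcs G" "(f i, f (i + 1)) \<in> parcs G" using f(3)[of "i - 1"] f(3)[of i] that by auto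
    then have "(f i, f i) \<in> (parcs G)\<^sup>+" using eq by (metis trancl.simps)
    then show False using acyc unfolding acyclic_def by blast
  qed
  then have "s_arc G s u v ?xs"
    unfolding s_arc_def using f V nth by (auto simp del: upt_Suc)
  then show "v \<in> desc G u" unfolding desc_def desc_at_def by blast
qed

end

lemma arcs_ends_induce:
  "(u, v) \<in> arcs_ends (with_proj D \<restriction> S) \<longleftrightarrow> u \<in> S \<and> v \<in> S \<and> (u, v) \<in> parcs D"
  by (auto simp: arcs_ends_conv image_iff)

section \<open>Vertices with the same out-neighbours are sinks of the same alternet\<close>

locale acyclic_homogeneous_digraph = pair_loopfree_digraph D for D :: "'a pair_pre_digraph" +
  fixes m :: nat
  assumes connected: "connected (with_proj D)"
    and homogeneous: "weakly_descendant_homogeneous D"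
    and out_valency: "has_out_valency D m" "1 < m"
    and acyclic: "acyclic (parcs D)"
begin

lemma vertex_transitiveE:
  assumes "u \<in> pverts D" "v \<in> pverts D"
  obtains g where "automorphism D g" "g u = v"
  using assms homogeneous unfolding weakly_descendant_homogeneous_def vertex_transitive_def by blast

lemma out_neighbours:
  assumes "v \<in> pverts D"
  shows "finite (parcs D `` {v})" "card (parcs D `` {v}) = m"
proof -
  have eq: "out_arcs (with_proj D) v = Pair v ` (parcs D `` {v})" by (auto simp: out_arcs_def)
  have "inj_on (Pair v) (parcs D `` {v})" by (auto simp: inj_on_def)
  moreover have "finite (out_arcs (with_proj D) v)" "card (out_arcs (with_proj D) v) = m"
    using out_valency(1) assms unfolding has_out_valency_def out_degree_def by blast+
  ultimately show "finite (parcs D `` {v})" "card (parcs D `` {v}) = m"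
    unfolding eq by (simp_all add: card_image finite_image_iff)
qed

lemma ex_out_neighbour:
  assumes "v \<in> pverts D"
  obtains w where "(v, w) \<in> parcs D"
proof -
  have "parcs D `` {v} \<noteq> {}" using out_neighbours[OF assms] out_valency(2) by auto
  then show ?thesis using that by blast
qed

lemma pverts_nonempty: "pverts D \<noteq> {}"
  using connected by (auto simp: connected_def strongly_connected_def)

text \<open>An out-neighbour of \<open>v\<close> has an in-neighbour, and vertex transitivity
  carries this back to \<open>v\<close>.\<close>

lemma ex_in_neighbour:
  assumes "v \<in> pverts D"
  obtains u where "(u, v) \<in> parcs D"
proof -
  obtain w where w: "(v, w) \<in> parcs D" using ex_out_neighbour[OF assms] .
  obtain g where g: "automorphism D g" "g w = v"
    using vertex_transitiveE[OF parcs_in_pverts(2)[OF w] assms] .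
  have "(g v, v) \<in> parcs D"
    using g w assms parcs_in_pverts(2)[OF w] unfolding automorphism_iff by metis
  then show ?thesis using that by blast
qed

lemma not_in_trancl: "(x, x) \<notin> (parcs D)\<^sup>+"
  using acyclic unfolding acyclic_def by blast

lemma delta_in_pverts:
  assumes "(u, v) \<in> delta D"
  shows "u \<in> pverts D" "v \<in> pverts D"
  using assms unfolding delta_def by auto

lemma delta_sym: "(u, v) \<in> delta D \<Longrightarrow> (v, u) \<in> delta D"
  by (auto simp: delta_def)

lemma delta_trans: "(u, v) \<in> delta D \<Longrightarrow> (v, w) \<in> delta D \<Longrightarrow> (u, w) \<in> delta D"
  by (auto simp: delta_def)

lemma delta_not_desc:
  assumes "(u, v) \<in> delta D"
  shows "(u, v) \<notin> (parcs D)\<^sup>+"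
  using delta_imp_same_trancl[OF assms] not_in_trancl[of v] by blast

lemma delta_swap:
  assumes d: "(x1, x2) \<in> delta D" and w: "w \<in> pverts D"
    and n1: "(w, x1) \<notin> (parcs D)\<^sup>*" and n2: "(w, x2) \<notin> (parcs D)\<^sup>*"
  obtains g where "automorphism D g" "g w = w" "g x1 = x2"
proof -
  let ?E = "parcs D"
  \<comment> \<open>\<open>Q\<close> collects the proper descendants of \<open>x1\<close>, which are
    also those of \<open>x2\<close>, and all descendants of \<open>w\<close>. Each of the two
    descendant sets in question is \<open>Q\<close> with a single vertex added.\<close>
  define Q where "Q = ?E\<^sup>+ `` {x1} \<union> ?E\<^sup>* `` {w}"
  have Q': "Q = ?E\<^sup>+ `` {x2} \<union> ?E\<^sup>* `` {w}"
    unfolding Q_def using delta_imp_same_trancl[OF d] by simp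
  have "x1 \<notin> Q" unfolding Q_def using n1 not_in_trancl[of x1] by simp
  moreover have "x2 \<notin> Q" unfolding Q' using n2 not_in_trancl[of x2] by simp
  ultimately have x: "x1 \<notin> Q" "x2 \<notin> Q" by simp_all
  have V: "x1 \<in> pverts D" "x2 \<in> pverts D" using delta_in_pverts[OF d] .
  have S1: "desc_set D {x1, w} = insert x1 Q" and S2: "desc_set D {x2, w} = insert x2 Q"
  proof -
    have *: "?E\<^sup>* `` {x} = insert x (?E\<^sup>+ `` {x})" for x by (auto simp: rtrancl_eq_or_trancl)
    show "desc_set D {x1, w} = insert x1 Q"
      unfolding desc_set_def using desc_eq_rtrancl[OF acyclic] V w *[of x1] by (simp add: Q_def)
    show "desc_set D {x2, w} = insert x2 Q"
      unfolding desc_set_def using desc_eq_rtrancl[OF acyclic] V w *[of x2] by (simp add: Q')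
  qed
  \<comment> \<open>No arc leads from \<open>Q\<close> to \<open>x1\<close> or \<open>x2\<close>, so
    the exchange affects only arcs that start at \<open>x1\<close>, and these have the same heads as
    the arcs from \<open>x2\<close>.\<close>
  have closed: "v \<in> Q" if "u \<in> Q" "(u, v) \<in> ?E" for u v
    using that unfolding Q_def by (auto intro: trancl.trancl_into_trancl rtrancl.rtrancl_into_rtrancl)
  define f where "f = (\<lambda>v. if v = x1 then x2 else v)"
  have fQ: "f v = v" if "v \<in> Q" for v using that x unfolding f_def by auto
  have out: "(x1, v) \<in> ?E \<longleftrightarrow> (x2, v) \<in> ?E" for v using d unfolding delta_def by blast
  have loop: "(x1, x1) \<notin> ?E" "(x2, x2) \<notin> ?E" using not_in_trancl by auto
  have "bij_betw f (insert x1 Q) (insert x2 Q)"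
    unfolding bij_betw_def inj_on_def using fQ x by (auto simp: f_def)
  moreover have "(u, v) \<in> ?E \<longleftrightarrow> (f u, f v) \<in> ?E" if "u \<in> insert x1 Q" "v \<in> insert x1 Q" for u v
  proof (cases "v = x1")
    case True
    then show ?thesis using that closed x fQ loop unfolding f_def by auto
  next
    case False
    then show ?thesis using that fQ out unfolding f_def by auto
  qed
  moreover have "f u \<in> insert x2 Q" if "u \<in> insert x1 Q" for u using that fQ by (auto simp: f_def)
  ultimately have "dg_isom f (with_proj D \<restriction> desc_set D {x1, w}) (with_proj D \<restriction> desc_set D {x2, w})"
    unfolding dg_isom_def S1 S2 induce_subgraph_verts arcs_ends_induce by blast
  moreover have "finite {x1, w}" "{x1, w} \<subseteq> pverts D" "finite {x2, w}" "{x2, w} \<subseteq> pverts D"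
    using V w by auto
  ultimately obtain g where "automorphism D g" "\<forall>x\<in>{x1, w}. g x = f x"
    using homogeneous unfolding weakly_descendant_homogeneous_def by meson
  moreover have "f w = w" using fQ unfolding Q_def by blast
  ultimately show ?thesis using that unfolding f_def by simp
qed

text \<open>The tails can be quantified existentially because edges with a common head always lie in
  one class; \<open>cosink_iff\<close> makes the relation independent of their choice.\<close>

definition cosink :: "'a rel" where
  "cosink = {(y, z). \<exists>u v. ((u, y), (v, z)) \<in> edge_reach D}"

lemma edge_reach_arcs: "(e, e') \<in> edge_reach D \<Longrightarrow> e \<in> parcs D \<and> e' \<in> parcs D"
  by (auto simp: edge_reach_def)

lemma edge_reach_sym: "(e, e') \<in> edge_reach D \<Longrightarrow> (e', e) \<in> edge_reach D"
  using equiv_edge_reach[OF acyclic] unfolding equiv_def by (meson symD)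

lemma edge_reach_trans: "(a, b) \<in> edge_reach D \<Longrightarrow> (b, c) \<in> edge_reach D \<Longrightarrow> (a, c) \<in> edge_reach D"
  using equiv_edge_reach[OF acyclic] unfolding equiv_def by (meson transD)

lemma cosink_iff:
  assumes "(u, y) \<in> parcs D" "(v, z) \<in> parcs D"
  shows "(y, z) \<in> cosink \<longleftrightarrow> ((u, y), (v, z)) \<in> edge_reach D"
proof
  assume "(y, z) \<in> cosink"
  then obtain u' v' where e: "((u', y), (v', z)) \<in> edge_reach D" unfolding cosink_def by auto
  have "((u, y), (u', y)) \<in> edge_reach D" "((v', z), (v, z)) \<in> edge_reach D"
    using assms edge_reach_arcs[OF e] by (auto intro: coincident_edge_reach[OF acyclic])
  then show "((u, y), (v, z)) \<in> edge_reach D" using e edge_reach_trans by blast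
qed (auto simp: cosink_def)

lemma cosink_in_pverts:
  assumes "(y, z) \<in> cosink" shows "y \<in> pverts D" "z \<in> pverts D"
  using assms edge_reach_arcs parcs_in_pverts unfolding cosink_def by blast+

lemma cosink_sym: "(y, z) \<in> cosink \<Longrightarrow> (z, y) \<in> cosink"
  unfolding cosink_def using edge_reach_sym by blast

lemma cosink_trans:
  assumes "(x, y) \<in> cosink" "(y, z) \<in> cosink" shows "(x, z) \<in> cosink"
proof -
  obtain u v where 1: "((u, x), (v, y)) \<in> edge_reach D" using assms(1) unfolding cosink_def by auto
  obtain v' w where 2: "((v', y), (w, z)) \<in> edge_reach D" using assms(2) unfolding cosink_def by auto
  have "((v, y), (v', y)) \<in> edge_reach D"
    using edge_reach_arcs[OF 1] edge_reach_arcs[OF 2] by (auto intro: coincident_edge_reach[OF acyclic])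
  then show ?thesis unfolding cosink_def using 1 2 edge_reach_trans by blast
qed

lemma out_neighbours_cosink:
  assumes "(u, y) \<in> parcs D" "(u, z) \<in> parcs D" shows "(y, z) \<in> cosink"
  using assms unfolding cosink_iff[OF assms] by (auto intro: coincident_edge_reach[OF acyclic])

lemma automorphism_cosink:
  assumes "automorphism D g" "(y, z) \<in> cosink" shows "(g y, g z) \<in> cosink"
proof -
  obtain u v where "((u, y), (v, z)) \<in> edge_reach D" using assms(2) unfolding cosink_def by blast
  from automorphism_edge_reach[OF acyclic assms(1) this] show ?thesis
    unfolding cosink_def by (simp only: map_prod_simp) blast
qed

lemma delta_imp_cosink:
  assumes nontriv: "delta_nontrivial_on D (pverts D)" and d: "(y, z) \<in> delta D"
  shows "(y, z) \<in> cosink"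
proof -
  have other: "\<exists>v'. v' \<noteq> v \<and> (v, v') \<in> delta D" if v: "v \<in> pverts D" for v
  proof -
    obtain a b where ab: "a \<noteq> b" "(a, b) \<in> delta D" using nontriv unfolding delta_nontrivial_on_def by blast
    note V = delta_in_pverts[OF ab(2)]
    obtain g where g: "automorphism D g" "g a = v" using vertex_transitiveE[OF V(1) v] .
    have "inj_on g (pverts D)" using g(1) unfolding automorphism_iff bij_betw_def by blast
    then have "g b \<noteq> v" using ab(1) V g(2) by (metis inj_onD)
    then show ?thesis using automorphism_delta_iff[OF g(1) V] ab(2) g(2) by blast
  qed
  have "\<exists>a b. a \<noteq> b \<and> (a, b) \<in> delta D \<and> (a, b) \<in> cosink"
  proof (rule ccontr)
    assume "\<not> ?thesis"
    then have none: False if "a \<noteq> b" "(a, b) \<in> delta D" "(a, b) \<in> cosink" for a b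
      using that by metis
    obtain u where u: "u \<in> pverts D" using pverts_nonempty by blast
    have "\<not> card (parcs D `` {u}) \<le> 1" using out_neighbours[OF u] out_valency(2) by simp
    then obtain a b where ab: "(u, a) \<in> parcs D" "(u, b) \<in> parcs D" "a \<noteq> b"
      using out_neighbours(1)[OF u] by (auto simp: card_le_Suc0_iff_eq)
    \<comment> \<open>Under the assumption \<open>none\<close>, no automorphism fixes
      \<open>w\<close> and moves \<open>x\<close> to another vertex \<open>x'\<close> of its
      delta-class, for \<open>w\<close> would be a cosink of both. So \<open>delta_swap\<close> must
      be inapplicable, which means that \<open>w\<close> lies above \<open>x\<close> or
      \<open>x'\<close>.\<close>
    have dominated: "\<exists>x'. (x, x') \<in> delta D \<and> (w, x') \<in> (parcs D)\<^sup>+"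
      if wx: "(w, x) \<in> cosink" "w \<noteq> x" for w x
    proof (rule ccontr)
      assume no: "\<not> ?thesis"
      note V = cosink_in_pverts[OF wx(1)]
      obtain x' where x': "x' \<noteq> x" "(x, x') \<in> delta D" using other[OF V(2)] by blast
      have "w \<noteq> x'" using none[OF x'(1)] wx(1) delta_sym[OF x'(2)] by metis
      then have "(w, x') \<notin> (parcs D)\<^sup>*" using no x'(2) by (auto simp: rtrancl_eq_or_trancl)
      moreover have "(x, x) \<in> delta D" using V by (auto simp: delta_def)
      then have "(w, x) \<notin> (parcs D)\<^sup>*" using no wx(2) by (auto simp: rtrancl_eq_or_trancl)
      ultimately obtain g where "automorphism D g" "g w = w" "g x = x'"
        using delta_swap[OF x'(2) V(1)] by blast
      then have "(w, x') \<in> cosink" using automorphism_cosink wx(1) by metis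
      with cosink_sym[OF wx(1)] have "(x, x') \<in> cosink" by (rule cosink_trans)
      then show False using none x' by metis
    qed
    obtain b' where b': "(b, b') \<in> delta D" "(a, b') \<in> (parcs D)\<^sup>+"
      using dominated[OF out_neighbours_cosink[OF ab(1,2)] ab(3)] by blast
    obtain a' where a': "(a, a') \<in> delta D" "(b, a') \<in> (parcs D)\<^sup>+"
      using dominated[OF out_neighbours_cosink[OF ab(2,1)]] ab(3) by blast
    have "(b', a') \<in> (parcs D)\<^sup>+" using delta_imp_same_trancl[OF b'(1)] a'(2) by (simp add: set_eq_iff)
    with b'(2) have "(a, a') \<in> (parcs D)\<^sup>+" by (rule trancl_trans)
    then show False using delta_not_desc[OF a'(1)] by blast
  qed
  then obtain a b where ab: "a \<noteq> b" "(a, b) \<in> delta D" "(a, b) \<in> cosink" by metis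
  note V = delta_in_pverts[OF ab(2)]
  note W = delta_in_pverts[OF d]
  obtain g where g: "automorphism D g" "g a = y" using vertex_transitiveE[OF V(1) W(1)] .
  have "inj_on g (pverts D)" using g(1) unfolding automorphism_iff bij_betw_def by blast
  then have ne: "g b \<noteq> y" using ab(1) V g(2) by (metis inj_onD)
  have gb: "(y, g b) \<in> delta D" "(y, g b) \<in> cosink"
    using automorphism_delta_iff[OF g(1) V] automorphism_cosink[OF g(1) ab(3)] ab(2) g(2) by auto
  show ?thesis
  proof (cases "z = y")
    case True
    then show ?thesis using cosink_trans[OF gb(2) cosink_sym[OF gb(2)]] by simp
  next
    case False
    have "(g b, z) \<in> delta D" using delta_trans[OF delta_sym[OF gb(1)] d] .
    moreover have "(y, z) \<notin> (parcs D)\<^sup>*" "(y, g b) \<notin> (parcs D)\<^sup>*"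
      using delta_not_desc gb(1) d False ne by (auto simp: rtrancl_eq_or_trancl)
    \<comment> \<open>With \<open>y\<close> as the fixed vertex, the exchange moves the known cosink
      \<open>g b\<close> of \<open>y\<close> to an arbitrary \<open>z\<close> in the same
      delta-class.\<close>
    ultimately obtain h where "automorphism D h" "h y = y" "h (g b) = z"
      using delta_swap[OF _ W(1)] by blast
    then show ?thesis using automorphism_cosink gb(2) by metis
  qed
qed

end

section \<open>Inverse and composite isomorphisms\<close>

lemma dg_isom_sym:
  assumes "dg_isom f G H"
  shows "dg_isom (inv_into (verts G) f) H G"
proof -
  have f: "bij_betw f (verts G) (verts H)" using assms unfolding dg_isom_def by blast
  let ?i = "inv_into (verts G) f"
  have i: "bij_betw ?i (verts H) (verts G)" using bij_betw_inv_into[OF f] .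
  have fi: "f (?i v) = v" if "v \<in> verts H" for v using bij_betw_inv_into_right[OF f that] .
  have iV: "?i v \<in> verts G" if "v \<in> verts H" for v using i that by (auto simp: bij_betw_def)
  have "u \<rightarrow>\<^bsub>H\<^esub> v \<longleftrightarrow> ?i u \<rightarrow>\<^bsub>G\<^esub> ?i v" if "u \<in> verts H" "v \<in> verts H" for u v
    using assms iV[OF that(1)] iV[OF that(2)] fi[OF that(1)] fi[OF that(2)] unfolding dg_isom_def by metis
  then show ?thesis unfolding dg_isom_def using i by blast
qed

lemma dg_isom_trans:
  assumes "dg_isom f G H" "dg_isom g H K"
  shows "dg_isom (g \<circ> f) G K"
proof -
  have f: "bij_betw f (verts G) (verts H)" and g: "bij_betw g (verts H) (verts K)"
    using assms unfolding dg_isom_def by blast+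
  have fV: "f v \<in> verts H" if "v \<in> verts G" for v using f that by (auto simp: bij_betw_def)
  have "u \<rightarrow>\<^bsub>G\<^esub> v \<longleftrightarrow> (g \<circ> f) u \<rightarrow>\<^bsub>K\<^esub> (g \<circ> f) v" if "u \<in> verts G" "v \<in> verts G" for u v
    using assms that fV[OF that(1)] fV[OF that(2)] unfolding dg_isom_def by simp
  then show ?thesis unfolding dg_isom_def using bij_betw_trans[OF f g] by blast
qed

section \<open>Directed trees of out-valency 1\<close>

lemma connected_iff_rtrancl:
  assumes "pair_wf_digraph G"
  shows "connected (with_proj G) \<longleftrightarrow> pverts G \<noteq> {} \<and>
    (\<forall>u\<in>pverts G. \<forall>v\<in>pverts G. (u, v) \<in> (parcs G \<union> (parcs G)\<inverse>)\<^sup>*)"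
proof -
  interpret pair_wf_digraph G by fact
  let ?R = "parcs G \<union> (parcs G)\<inverse>"
  have R: "symcl (parcs G) = ?R" by (auto simp: symcl_def)
  have sub: "(u, v) \<in> ?R \<Longrightarrow> v \<in> pverts G" for u v
    using in_arcsD1 in_arcsD2 by blast
  have on: "(u, v) \<in> rtrancl_on (pverts G) ?R \<longleftrightarrow> (u, v) \<in> ?R\<^sup>*" if "u \<in> pverts G" for u v
  proof
    assume "(u, v) \<in> ?R\<^sup>*"
    then show "(u, v) \<in> rtrancl_on (pverts G) ?R"
    proof (induction rule: rtrancl_induct)
      case base
      then show ?case using that by simp
    next
      case (step y z)
      then show ?case using sub by (meson rtrancl_on_into_rtrancl_on)
    qed
  qed (rule rtrancl_on_rtranclI)
  show ?thesis unfolding connected_conv by (simp add: R on)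
qed

lemma parcs_mk_symmetric_iff:
  "(x, y) \<in> parcs (mk_symmetric (with_proj T)) \<longleftrightarrow> (x, y) \<in> parcs T \<or> (y, x) \<in> parcs T"
  by (auto simp: parcs_mk_symmetric Bex_def)

text \<open>The arcs among the vertices of a cycle form a finite acyclic relation, so some vertex
  \<open>z\<close> of the cycle has no arc coming from the cycle. Both neighbours of
  \<open>z\<close> along the cycle are then out-neighbours, and they are distinct.\<close>

lemma no_undirected_cycle:
  assumes sv: "single_valued (parcs T)" and acyc: "acyclic (parcs T)"
  shows "\<not> undirected_cycle T xs"
proof
  assume c: "undirected_cycle T xs"
  let ?n = "length xs"
  have n: "3 \<le> ?n" and d: "distinct xs"
    and adj: "\<And>i. i < ?n \<Longrightarrow> (xs ! i, xs ! ((i + 1) mod ?n)) \<in> parcs (mk_symmetric (with_proj T))"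
    using c unfolding undirected_cycle_def by auto
  define r where "r = parcs T \<inter> set xs \<times> set xs"
  have "finite r" unfolding r_def by (rule finite_subset[OF Int_lower2]) simp
  moreover have "acyclic r" unfolding r_def by (rule acyclic_subset[OF acyc Int_lower1])
  ultimately have "wf r" by (rule finite_acyclic_wf)
  moreover have "xs ! 0 \<in> set xs" using n by (intro nth_mem) linarith
  ultimately obtain z where z: "z \<in> set xs" "\<And>y. (y, z) \<in> r \<Longrightarrow> y \<notin> set xs"
    using wfE_min by metis
  then obtain i where i: "i < ?n" "xs ! i = z" by (metis in_set_conv_nth)
  \<comment> \<open>The cyclic predecessor and successor of position \<open>i\<close>; they differ
    because the length is at least 3.\<close>
  define p where "p = (if i = 0 then ?n - 1 else i - 1)"
  define q where "q = (i + 1) mod ?n"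
  have p: "p < ?n" "(p + 1) mod ?n = i" using i(1) n unfolding p_def by auto
  have q: "q < ?n" using n unfolding q_def by (intro mod_less_divisor) linarith
  have pq: "p \<noteq> q"
  proof (cases "i + 1 < ?n")
    case True
    then show ?thesis using n i(1) unfolding p_def q_def by auto
  next
    case False
    then have "i + 1 = ?n" using i(1) by simp
    then show ?thesis using n unfolding p_def q_def by auto
  qed
  have min: "(xs ! j, z) \<notin> parcs T" if "j < ?n" for j
    using z that unfolding r_def by (meson IntI SigmaI nth_mem)
  have "(z, xs ! q) \<in> parcs T" "(z, xs ! p) \<in> parcs T"
    using adj[OF i(1)] adj[OF p(1)] min[OF p(1)] min[OF q]
    unfolding parcs_mk_symmetric_iff p(2) i(2) q_def[symmetric] by blast+
  then have "xs ! p = xs ! q" using sv by (meson single_valuedD)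
  then show False using d p(1) q pq by (metis nth_eq_iff_index_eq)
qed

text \<open>Replaces the tree by its parent map. An orbit never returns, because a shortest return
  would be a loop, a pair of opposite arcs or an undirected cycle. Any two orbits merge, by
  induction along an undirected walk between their starting points.\<close>

lemma directed_tree_up:
  assumes tree: "directed_tree T" and out: "has_out_valency T 1"
  obtains up where "\<forall>t\<in>pverts T. up t \<in> pverts T"
    and "\<forall>s t. (s, t) \<in> parcs T \<longleftrightarrow> s \<in> pverts T \<and> t = up s"
    and "\<forall>t\<in>pverts T. \<forall>n. (up ^^ Suc n) t \<noteq> t"
    and "\<forall>s\<in>pverts T. \<forall>t\<in>pverts T. \<exists>i j. (up ^^ i) s = (up ^^ j) t"
proof -
  interpret pair_loopfree_digraph T using tree unfolding directed_tree_def by blast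
  have "\<exists>t. \<forall>t'. (s, t') \<in> parcs T \<longleftrightarrow> t' = t" if "s \<in> pverts T" for s
  proof -
    have "card (out_arcs (with_proj T) s) = 1"
      using out that unfolding has_out_valency_def out_degree_def by blast
    then obtain e where e: "out_arcs (with_proj T) s = {e}" by (rule card_1_singletonE)
    have "(s, t') \<in> parcs T \<longleftrightarrow> (s, t') = e" for t'
      using e unfolding out_arcs_def by (auto simp: set_eq_iff)
    moreover have "fst e = s" using e by (metis in_out_arcs_conv insertI1 with_proj_simps(4))
    ultimately have "\<forall>t'. (s, t') \<in> parcs T \<longleftrightarrow> t' = snd e" by (metis prod.collapse prod.inject)
    then show ?thesis by blast
  qed
  then obtain up where up: "\<And>s t'. s \<in> pverts T \<Longrightarrow> (s, t') \<in> parcs T \<longleftrightarrow> t' = up s" by metis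
  have up_V: "up t \<in> pverts T" if "t \<in> pverts T" for t
    using up[OF that, of "up t"] in_arcsD2 by blast
  have arc: "(s, t) \<in> parcs T \<longleftrightarrow> s \<in> pverts T \<and> t = up s" for s t
    using up in_arcsD1 by blast
  have pow_V: "(up ^^ n) t \<in> pverts T" if "t \<in> pverts T" for t n
    by (induction n) (auto simp: that up_V)
  have acyc: False if t: "t \<in> pverts T" and n: "0 < n" "(up ^^ n) t = t"
    and least: "\<And>k. 0 < k \<Longrightarrow> k < n \<Longrightarrow> (up ^^ k) t \<noteq> t" for t n
  proof -
    have a0: "(t, up t) \<in> parcs T" using arc t by blast
    \<comment> \<open>\<open>undirected_cycle\<close> asks for at least 3 vertices, so the periods 1
      and 2 are excluded separately.\<close>
    consider "n = 1" | "n = 2" | "3 \<le> n" using n(1) by linarith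
    then show False
    proof cases
      case 1
      then show False using n(2) a0 no_loops by fastforce
    next
      case 2
      then have "(up t, t) \<in> parcs T" using n(2) arc up_V[OF t] by (simp add: numeral_2_eq_2)
      then show False using a0 tree unfolding directed_tree_def by blast
    next
      case 3
      let ?xs = "map (\<lambda>i. (up ^^ i) t) [0..<n]"
      \<comment> \<open>A repetition inside the orbit would give the period
        \<open>n - j + i\<close>, which is smaller than the least one.\<close>
      have ne: "(up ^^ i) t \<noteq> (up ^^ j) t" if ij: "i < j" "j < n" for i j
      proof
        assume eq: "(up ^^ i) t = (up ^^ j) t"
        have "(up ^^ (n - j + i)) t = (up ^^ (n - j)) ((up ^^ i) t)" by (simp add: funpow_add)
        also have "\<dots> = (up ^^ (n - j + j)) t" by (simp add: funpow_add eq)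
        also have "\<dots> = t" using ij n by simp
        finally have eqt: "(up ^^ (n - j + i)) t = t" .
        have "0 < n - j + i" "n - j + i < n" using ij by linarith+
        from least[OF this] eqt show False by (rule notE)
      qed
      have "distinct ?xs" unfolding distinct_conv_nth
        using ne by (auto simp: nth_map) (metis linorder_neqE_nat)
      moreover have "(?xs ! i, ?xs ! ((i + 1) mod length ?xs)) \<in> parcs (mk_symmetric (with_proj T))"
        if i: "i < length ?xs" for i
      proof -
        have "?xs ! i = (up ^^ i) t" using i by simp
        moreover have "?xs ! ((i + 1) mod length ?xs) = (up ^^ Suc i) t"
        proof (cases "i + 1 < n")
          case True
          then show ?thesis by simp
        next
          case False
          then have "i + 1 = n" using i by simp
          then show ?thesis using n 3 by auto
        qed
        ultimately show ?thesis unfolding parcs_mk_symmetric_iff using arc pow_V[OF t] by simp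
      qed
      ultimately have "undirected_cycle T ?xs" unfolding undirected_cycle_def using 3 by simp
      then show False using tree unfolding directed_tree_def by blast
    qed
  qed
  show ?thesis
  proof (rule that)
    show "\<forall>t\<in>pverts T. up t \<in> pverts T" "\<forall>s t. (s, t) \<in> parcs T \<longleftrightarrow> s \<in> pverts T \<and> t = up s"
      using up_V arc by blast+
    show "\<forall>t\<in>pverts T. \<forall>n. (up ^^ Suc n) t \<noteq> t"
    proof (intro ballI allI notI)
      fix t n assume t: "t \<in> pverts T"
      assume "(up ^^ Suc n) t = t"
      define k where "k = (LEAST k. 0 < k \<and> (up ^^ k) t = t)"
      have "0 < k \<and> (up ^^ k) t = t" unfolding k_def
        by (rule LeastI[of _ "Suc n"]) (use \<open>(up ^^ Suc n) t = t\<close> in blast)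
      moreover have "(up ^^ j) t \<noteq> t" if "0 < j" "j < k" for j
        using not_less_Least[of j "\<lambda>k. 0 < k \<and> (up ^^ k) t = t"] that unfolding k_def by blast
      ultimately show False using acyc[OF t] by blast
    qed
    show "\<forall>s\<in>pverts T. \<forall>t\<in>pverts T. \<exists>i j. (up ^^ i) s = (up ^^ j) t"
    proof (intro ballI)
      fix s t assume s: "s \<in> pverts T" and t: "t \<in> pverts T"
      have "(s, t) \<in> (parcs T \<union> (parcs T)\<inverse>)\<^sup>*"
        using tree s t connected_iff_rtrancl[of T] pair_wf_digraph_axioms
        unfolding directed_tree_def by blast
      then show "\<exists>i j. (up ^^ i) s = (up ^^ j) t"
      proof (induction rule: rtrancl_induct)
        case base
        then show ?case by blast
      next
        case (step y z)
        then obtain i j where ij: "(up ^^ i) s = (up ^^ j) y" by blast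
        show ?case
        proof (cases "(y, z) \<in> parcs T")
          case True
          have "(up ^^ Suc i) s = (up ^^ Suc j) y" using ij by simp
          also have "\<dots> = (up ^^ j) z" using True arc by (simp add: funpow_swap1)
          finally show ?thesis by blast
        next
          case False
          then have "(up ^^ j) y = (up ^^ Suc j) z" using step arc by (auto simp: funpow_swap1)
          then show ?thesis using ij by metis
        qed
      qed
    qed
  qed
qed

section \<open>Uniqueness of labelled trees\<close>

text \<open>Labels are attached to the lower vertex of an edge; \<open>a\<close> starts a ray with constant label \<open>s0\<close>.\<close>

definition based_tree :: "'t set \<Rightarrow> ('t \<Rightarrow> 't) \<Rightarrow> ('t \<Rightarrow> 'l) \<Rightarrow> 'l set \<Rightarrow> 't \<Rightarrow> 'l \<Rightarrow> bool" where
  "based_tree V up lab S a s0 \<longleftrightarrow> a \<in> V \<and> (\<forall>t\<in>V. up t \<in> V) \<and> (\<forall>t\<in>V. \<forall>n. (up ^^ Suc n) t \<noteq> t) \<and>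
     (\<forall>s\<in>V. \<forall>t\<in>V. \<exists>i j. (up ^^ i) s = (up ^^ j) t) \<and>
     (\<forall>t\<in>V. bij_betw lab {t'\<in>V. up t' = t} S) \<and> (\<forall>i. lab ((up ^^ i) a) = s0)"

text \<open>Relative to the ray, a vertex has an address: the number \<open>k\<close> of steps, the
  position \<open>i\<close> on the ray reached by them, and the labels read on the way. The relation
  says that \<open>v\<close> and \<open>w\<close> share an address. A vertex has many addresses,
  because the climb may continue along the ray.\<close>

definition matched_at :: "('t \<Rightarrow> 't) \<Rightarrow> ('t \<Rightarrow> 'l) \<Rightarrow> 't \<Rightarrow> ('s \<Rightarrow> 's) \<Rightarrow> ('s \<Rightarrow> 'l) \<Rightarrow> 's \<Rightarrow>
    't \<Rightarrow> 's \<Rightarrow> nat \<Rightarrow> nat \<Rightarrow> bool" where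
  "matched_at up lab a up' lab' a' v w i k \<longleftrightarrow> (up ^^ k) v = (up ^^ i) a \<and> (up' ^^ k) w = (up' ^^ i) a' \<and>
     (\<forall>j<k. lab ((up ^^ j) v) = lab' ((up' ^^ j) w))"

lemma matched_at_sym:
  "matched_at up lab a up' lab' a' v w i k \<longleftrightarrow> matched_at up' lab' a' up lab a w v i k"
  unfolding matched_at_def by auto

lemma based_tree_inj_ray:
  assumes "based_tree V up lab S a s0" "(up ^^ i) a = (up ^^ j) a"
  shows "i = j"
proof -
  have pV: "(up ^^ n) a \<in> V" for n
    using assms(1) unfolding based_tree_def by (induction n) auto
  have "\<not> i < j" if "(up ^^ i) a = (up ^^ j) a" for i j
  proof
    assume "i < j"
    then obtain d where "j = Suc d + i" by (metis add.commute less_imp_Suc_add add_Suc_right)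
    then have "(up ^^ Suc d) ((up ^^ i) a) = (up ^^ i) a" using that by (simp add: funpow_add)
    then show False using assms(1) pV unfolding based_tree_def by blast
  qed
  then show ?thesis using assms(2) by (metis linorder_neqE_nat)
qed

text \<open>Labels distinguish the children of a vertex and exhaust \<open>S\<close>, so a word of
  length \<open>k\<close> over \<open>S\<close> selects exactly one vertex \<open>k\<close> levels
  below \<open>t\<close>.\<close>

lemma based_tree_below:
  assumes B: "based_tree V up lab S a s0" and "t \<in> V" "\<And>j. j < k \<Longrightarrow> l j \<in> S"
  shows "\<exists>!v. v \<in> V \<and> (up ^^ k) v = t \<and> (\<forall>j<k. lab ((up ^^ j) v) = l j)"
  using assms(2,3)
proof (induction k arbitrary: t)
  case 0
  then show ?case by auto
next
  case (Suc k)
  have bij: "bij_betw lab {t'\<in>V. up t' = t} S" using B Suc.prems(1) unfolding based_tree_def by blast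
  have closed: "\<And>t. t \<in> V \<Longrightarrow> up t \<in> V" using B unfolding based_tree_def by blast
  have pV: "(up ^^ n) v \<in> V" if "v \<in> V" for n v by (induction n) (auto simp: that closed)
  \<comment> \<open>Letters are indexed from the bottom upwards, so the child of \<open>t\<close>
    carries the last one, \<open>l k\<close>.\<close>
  obtain t' where t': "t' \<in> V" "up t' = t" "lab t' = l k"
    using bij Suc.prems(2)[of k] unfolding bij_betw_def by (auto simp: image_iff set_eq_iff) (metis lessI)
  have uniq: "x = t'" if "x \<in> V" "up x = t" "lab x = l k" for x
    using bij that t' unfolding bij_betw_def inj_on_def by simp
  have eq: "v \<in> V \<and> (up ^^ Suc k) v = t \<and> (\<forall>j<Suc k. lab ((up ^^ j) v) = l j) \<longleftrightarrow>
    v \<in> V \<and> (up ^^ k) v = t' \<and> (\<forall>j<k. lab ((up ^^ j) v) = l j)" for v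
    using uniq[OF pV] t' by (auto simp: less_Suc_eq)
  have "\<exists>!v. v \<in> V \<and> (up ^^ k) v = t' \<and> (\<forall>j<k. lab ((up ^^ j) v) = l j)"
    using Suc.IH[OF t'(1)] Suc.prems(2) by simp
  then show ?case unfolding eq .
qed

text \<open>This is where the constant labels along the rays are used: once both orbits have reached
  their rays, they read only \<open>s0\<close>.\<close>

lemma matched_at_add:
  assumes B: "based_tree V up lab S a s0" "based_tree V' up' lab' S a' s0"
    and "matched_at up lab a up' lab' a' v w i k"
  shows "matched_at up lab a up' lab' a' v w (d + i) (d + k)"
proof (induction d)
  case 0
  then show ?case using assms(3) by simp
next
  case (Suc d)
  have "lab ((up ^^ (d + k)) v) = s0" "lab' ((up' ^^ (d + k)) w) = s0"
    using Suc B unfolding matched_at_def based_tree_def by metis+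
  then show ?case using Suc unfolding matched_at_def by (auto simp: less_Suc_eq)
qed

text \<open>The ray does not repeat, so the number of steps determines the position reached: a
  longer address is the shorter one continued along the ray.\<close>

lemma matched_at_offset:
  assumes B: "based_tree V up lab S a s0" and k: "k \<le> k'"
    and 1: "(up ^^ k) v = (up ^^ i) a" and 2: "(up ^^ k') v = (up ^^ i') a"
  shows "i' = (k' - k) + i"
proof -
  have "(up ^^ ((k' - k) + i)) a = (up ^^ (k' - k)) ((up ^^ k) v)" by (simp add: funpow_add 1)
  also have "\<dots> = (up ^^ (k' - k + k)) v" by (simp add: funpow_add)
  also have "\<dots> = (up ^^ i') a" using 2 k by simp
  finally show ?thesis using based_tree_inj_ray[OF B] by metis
qed

text \<open>For existence, the orbit of \<open>v\<close> meets the ray, and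
  \<open>based_tree_below\<close> descends from the corresponding point of the other ray along the
  labels of \<open>v\<close>. For uniqueness, the shorter of two addresses is prolonged to the
  length of the longer one.\<close>

lemma matched_ex1:
  assumes B: "based_tree V up lab S a s0" and B': "based_tree V' up' lab' S a' s0" and v: "v \<in> V"
  shows "\<exists>!w. w \<in> V' \<and> (\<exists>i k. matched_at up lab a up' lab' a' v w i k)"
proof -
  have closed: "\<And>t. t \<in> V \<Longrightarrow> up t \<in> V" "\<And>t. t \<in> V' \<Longrightarrow> up' t \<in> V'"
    using B B' unfolding based_tree_def by blast+
  have pV: "(up ^^ n) v \<in> V" if "v \<in> V" for n v by (induction n) (auto simp: that closed)
  have pV': "(up' ^^ n) v \<in> V'" if "v \<in> V'" for n v by (induction n) (auto simp: that closed)
  have a: "a \<in> V" "a' \<in> V'" using B B' unfolding based_tree_def by blast+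
  have lS: "lab t \<in> S" if "t \<in> V" for t
  proof -
    have "bij_betw lab {t'\<in>V. up t' = up t} S" using B closed(1)[OF that] unfolding based_tree_def by blast
    then show ?thesis using that unfolding bij_betw_def by blast
  qed
  note below = based_tree_below[OF B' pV'[OF a(2)] lS[OF pV[OF v]]]
  obtain k i where ki: "(up ^^ k) v = (up ^^ i) a" using B v a unfolding based_tree_def by blast
  obtain w where "w \<in> V'" "(up' ^^ k) w = (up' ^^ i) a'" "\<forall>j<k. lab' ((up' ^^ j) w) = lab ((up ^^ j) v)"
    using below[of k i "\<lambda>j. j"] by blast
  then have "w \<in> V' \<and> (\<exists>i k. matched_at up lab a up' lab' a' v w i k)"
    using ki unfolding matched_at_def by metis
  moreover have "w1 = w2" if w: "w1 \<in> V'" "w2 \<in> V'" and m1: "matched_at up lab a up' lab' a' v w1 i1 k1"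
    and m2: "matched_at up lab a up' lab' a' v w2 i2 k2" and le: "k1 \<le> k2" for w1 w2 i1 i2 k1 k2
  proof -
    have "i2 = (k2 - k1) + i1"
      using matched_at_offset[OF B le, of v i1 i2] m1 m2 unfolding matched_at_def by blast
    then have "matched_at up lab a up' lab' a' v w1 i2 k2"
      using matched_at_add[OF B B' m1, of "k2 - k1"] le by simp
    then show ?thesis using below[of k2 i2 "\<lambda>j. j"] m2 w unfolding matched_at_def by metis
  qed
  ultimately show ?thesis by (metis nle_le)
qed

lemma based_tree_iso:
  assumes B: "based_tree V up lab S a s0" and B': "based_tree V' up' lab' S a' s0"
  obtains h where "bij_betw h V V'" "\<forall>v\<in>V. h (up v) = up' (h v)" "\<forall>v\<in>V. lab' (h v) = lab v"
proof -
  have closed: "\<And>t. t \<in> V \<Longrightarrow> up t \<in> V" "\<And>t. t \<in> V' \<Longrightarrow> up' t \<in> V'"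
    using B B' unfolding based_tree_def by blast+
  define R where "R v w \<longleftrightarrow> (\<exists>i k. matched_at up lab a up' lab' a' v w i k)" for v w
  have ex: "\<exists>!w. w \<in> V' \<and> R v w" if "v \<in> V" for v
    unfolding R_def by (rule matched_ex1[OF B B' that])
  \<comment> \<open>Matching is symmetric in the two trees, so the same lemma applied the other way
    round makes it the graph of a bijection.\<close>
  have ex': "\<exists>!v. v \<in> V \<and> R v w" if "w \<in> V'" for w
    unfolding R_def matched_at_sym[of up] by (rule matched_ex1[OF B' B that])
  define h where "h v = (THE w. w \<in> V' \<and> R v w)" for v
  have h: "h v \<in> V'" "R v (h v)" if "v \<in> V" for v
    using theI'[OF ex[OF that]] unfolding h_def by blast+
  have bij: "bij_betw h V V'"
    unfolding bij_betw_def
  proof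
    show "inj_on h V" by (rule inj_onI) (metis ex' h)
    show "h ` V = V'" using h ex ex' by (auto simp: image_iff) metis
  qed
  have R: "R (up v) (up' w) \<and> lab' w = lab v" if "R v w" for v w
  proof -
    obtain i k where "matched_at up lab a up' lab' a' v w i k" using \<open>R v w\<close> unfolding R_def by blast
    \<comment> \<open>One more step makes the number of steps positive, so that the label of
      \<open>v\<close> itself is compared and the first step can be cut off to pass to
      \<open>up v\<close>.\<close>
    then have m: "matched_at up lab a up' lab' a' v w (Suc i) (Suc k)"
      using matched_at_add[OF B B', of v w i k 1] by simp
    then have "lab v = lab' w" unfolding matched_at_def by (metis funpow_0 zero_less_Suc)
    moreover have "matched_at up lab a up' lab' a' (up v) (up' w) (Suc i) k"
      using m unfolding matched_at_def by (simp del: funpow.simps add: funpow_Suc_right) (metis Suc_less_eq comp_apply funpow_Suc_right)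
    ultimately show ?thesis unfolding R_def by metis
  qed
  show ?thesis
  proof (rule that[OF bij]; intro ballI)
    fix v assume v: "v \<in> V"
    show "h (up v) = up' (h v)"
      using ex[OF closed(1)[OF v]] h[OF closed(1)[OF v]] h[OF v] R closed(2) by metis
    show "lab' (h v) = lab v" using R h[OF v] by blast
  qed
qed

section \<open>Normalising the labels, and uniqueness of D(m,M)\<close>

lemma m_subsets_permutation:
  assumes "s \<in> m_subsets m M" "s' \<in> m_subsets m M"
  obtains p where "bij_betw p (Omega M) (Omega M)" "p ` s = s'"
proof -
  have s: "s \<subseteq> Omega M" "finite s" "card s = m" and s': "s' \<subseteq> Omega M" "finite s'" "card s' = m"
    using assms unfolding m_subsets_def by auto
  \<comment> \<open>Only this set is moved. It is finite even for \<open>M = \<infinity>\<close>, so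
    the complements of \<open>s\<close> and \<open>s'\<close> in it have the same size.\<close>
  let ?F = "s \<union> s'"
  obtain a where a: "bij_betw a s s'" using finite_same_card_bij[OF s(2) s'(2)] s s' by auto
  have "card (?F - s) = card (?F - s')"
    using s s' by (metis Un_upper1 Un_upper2 card_Diff_subset)
  then obtain b where b: "bij_betw b (?F - s) (?F - s')"
    using finite_same_card_bij s s' by (metis finite_Diff finite_UnI)
  define p where "p x = (if x \<in> s then a x else if x \<in> ?F then b x else x)" for x
  have 1: "bij_betw p s s'" using a by (rule iffD1[OF bij_betw_cong, rotated]) (simp add: p_def)
  have 2: "bij_betw p (?F - s) (?F - s')" using b by (rule iffD1[OF bij_betw_cong, rotated]) (auto simp: p_def)
  have 3: "bij_betw p (Omega M - ?F) (Omega M - ?F)"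
    using bij_betw_id by (rule iffD1[OF bij_betw_cong, rotated]) (simp add: p_def)
  have "bij_betw p (s \<union> (?F - s)) (s' \<union> (?F - s'))" by (rule bij_betw_combine[OF 1 2]) auto
  then have "bij_betw p ?F ?F" by (metis Un_Diff_cancel Un_absorb Un_assoc Un_commute)
  then have "bij_betw p (?F \<union> (Omega M - ?F)) (?F \<union> (Omega M - ?F))"
    by (rule bij_betw_combine[OF _ 3]) auto
  moreover have "?F \<union> (Omega M - ?F) = Omega M" using s s' by auto
  ultimately show ?thesis using that 1 by (simp add: bij_betw_def)
qed

text \<open>An arc into \<open>(t, a)\<close> tests whether \<open>a\<close> lies in a label at
  \<open>t\<close> and ignores which element of \<open>Omega M\<close> its tail carries. So the
  labels at \<open>t\<close> absorb the permutation at \<open>t\<close>, and permutations at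
  different vertices do not interfere.\<close>

lemma D_digraph_relabel:
  assumes T: "labelled_regular_tree m M T \<phi>"
    and \<pi>: "\<And>t. t \<in> pverts T \<Longrightarrow> bij_betw (\<pi> t) (Omega M) (Omega M)"
  shows "dg_isom (\<lambda>(t, a). (t, \<pi> t a)) (with_proj (D_digraph M T \<phi>)) (with_proj (D_digraph M T (\<lambda>t t'. \<pi> t ` \<phi> t t')))"
proof -
  let ?f = "\<lambda>(t, a). (t, \<pi> t a)"
  have inj: "inj_on (\<pi> t) (Omega M)" "\<pi> t ` Omega M = Omega M" if "t \<in> pverts T" for t
    using \<pi>[OF that] by (auto simp: bij_betw_def)
  have \<phi>: "\<phi> t t' \<subseteq> Omega M" if "(t', t) \<in> parcs T" "t \<in> pverts T" for t t'
    using T that unfolding labelled_regular_tree_def m_subsets_def bij_betw_def by blast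
  have "bij_betw ?f (pverts T \<times> Omega M) (pverts T \<times> Omega M)"
    unfolding bij_betw_def
  proof
    show "inj_on ?f (pverts T \<times> Omega M)" using inj(1) by (auto simp: inj_on_def)
    show "?f ` (pverts T \<times> Omega M) = pverts T \<times> Omega M"
      using inj(2) by (fastforce simp: image_iff set_eq_iff)
  qed
  moreover have "(u, v) \<in> parcs (D_digraph M T \<phi>) \<longleftrightarrow>
      (?f u, ?f v) \<in> parcs (D_digraph M T (\<lambda>t t'. \<pi> t ` \<phi> t t'))"
    if uv: "u \<in> pverts T \<times> Omega M" "v \<in> pverts T \<times> Omega M" for u v
  proof -
    obtain t' c t a where e: "u = (t', c)" "v = (t, a)" by (cases u, cases v)
    have V: "t' \<in> pverts T" "t \<in> pverts T" "c \<in> Omega M" "a \<in> Omega M" using uv e by auto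
    have "a \<in> \<phi> t t' \<longleftrightarrow> \<pi> t a \<in> \<pi> t ` \<phi> t t'" if "(t', t) \<in> parcs T"
      using inj_on_image_mem_iff[OF inj(1)[OF V(2)] V(4) \<phi>[OF that V(2)]] by simp
    moreover have "\<pi> t' c \<in> Omega M" using inj(2)[OF V(1)] V(3) by blast
    ultimately show ?thesis unfolding e D_digraph_def using V by auto
  qed
  ultimately show ?thesis unfolding dg_isom_def by (simp add: D_digraph_def)
qed

text \<open>The ray from \<open>a\<close> enters a tree vertex at most once, so one permutation
  there can turn the label of the entering arc into \<open>s0\<close>. At vertices that the ray does
  not enter any permutation will do.\<close>

lemma labelled_regular_tree_based:
  assumes T: "labelled_regular_tree m M T \<phi>" and s0: "s0 \<in> m_subsets m M"
  obtains \<phi>' up a f where "dg_isom f (with_proj (D_digraph M T \<phi>)) (with_proj (D_digraph M T \<phi>'))"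
    "based_tree (pverts T) up (\<lambda>t. \<phi>' (up t) t) (m_subsets m M) a s0"
    "\<forall>s t. (s, t) \<in> parcs T \<longleftrightarrow> s \<in> pverts T \<and> t = up s"
proof -
  have tree: "directed_tree T" "has_out_valency T 1" using T unfolding labelled_regular_tree_def by blast+
  obtain up where up: "\<forall>t\<in>pverts T. up t \<in> pverts T"
    and arcs: "\<forall>s t. (s, t) \<in> parcs T \<longleftrightarrow> s \<in> pverts T \<and> t = up s"
    and acyc: "\<forall>t\<in>pverts T. \<forall>n. (up ^^ Suc n) t \<noteq> t"
    and confl: "\<forall>s\<in>pverts T. \<forall>t\<in>pverts T. \<exists>i j. (up ^^ i) s = (up ^^ j) t"
    using directed_tree_up[OF tree] .
  note arc = arcs[rule_format]
  obtain a where a: "a \<in> pverts T"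
    using T unfolding labelled_regular_tree_def by (metis all_not_in_conv finite.emptyI)
  have pV: "(up ^^ n) v \<in> pverts T" if "v \<in> pverts T" for n v by (induction n) (auto simp: that up)
  have bij: "bij_betw (\<phi> t) {t'. (t', t) \<in> parcs T} (m_subsets m M)" if "t \<in> pverts T" for t
    using T that unfolding labelled_regular_tree_def by blast
  have nlt: "\<not> i < j" if "(up ^^ i) a = (up ^^ j) a" for i j
  proof
    assume "i < j"
    then obtain d where "j = Suc d + i" by (metis add.commute less_imp_Suc_add add_Suc_right)
    then have "(up ^^ Suc d) ((up ^^ i) a) = (up ^^ i) a" using that by (simp add: funpow_add)
    then show False using acyc pV[OF a] by blast
  qed
  have inj: "i = j" if "(up ^^ i) a = (up ^^ j) a" for i j
    using nlt[OF that] nlt[OF that[symmetric]] by simp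
  have "\<exists>p. bij_betw p (Omega M) (Omega M) \<and>
      (\<forall>i. t = (up ^^ Suc i) a \<longrightarrow> p ` \<phi> t ((up ^^ i) a) = s0)" if t: "t \<in> pverts T" for t
  proof (cases "\<exists>i. t = (up ^^ Suc i) a")
    case True
    then obtain i where i: "t = (up ^^ Suc i) a" by blast
    have "((up ^^ i) a, t) \<in> parcs T" unfolding arc i using pV[OF a] by simp
    then have "\<phi> t ((up ^^ i) a) \<in> m_subsets m M" using bij[OF t] unfolding bij_betw_def by blast
    then obtain p where p: "bij_betw p (Omega M) (Omega M)" "p ` \<phi> t ((up ^^ i) a) = s0"
      using m_subsets_permutation[OF _ s0] by metis
    have "p ` \<phi> t ((up ^^ j) a) = s0" if "t = (up ^^ Suc j) a" for j
      using inj[of "Suc i" "Suc j"] that i p by simp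
    then show ?thesis using p by blast
  next
    case False
    then show ?thesis using bij_betw_id by blast
  qed
  then obtain \<pi> where \<pi>: "\<And>t. t \<in> pverts T \<Longrightarrow> bij_betw (\<pi> t) (Omega M) (Omega M)"
    and \<pi>0: "\<And>t i. t \<in> pverts T \<Longrightarrow> t = (up ^^ Suc i) a \<Longrightarrow> \<pi> t ` \<phi> t ((up ^^ i) a) = s0" by metis
  let ?\<phi> = "\<lambda>t t'. \<pi> t ` \<phi> t t'"
  have im: "bij_betw ((`) (\<pi> t)) (m_subsets m M) (m_subsets m M)" if t: "t \<in> pverts T" for t
  proof -
    have p: "inj_on (\<pi> t) (Omega M)" "\<pi> t ` Omega M = Omega M" using \<pi>[OF t] by (auto simp: bij_betw_def)
    have "inj_on ((`) (\<pi> t)) (m_subsets m M)"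
      by (rule inj_on_subset[OF inj_on_image_Pow[OF p(1)]]) (auto simp: m_subsets_def)
    moreover have "\<pi> t ` s \<in> m_subsets m M" if "s \<in> m_subsets m M" for s
      using that p card_image[OF inj_on_subset[OF p(1)], of s] unfolding m_subsets_def by auto
    moreover have "s \<in> (`) (\<pi> t) ` m_subsets m M" if s: "s \<in> m_subsets m M" for s
    proof -
      have sO: "s \<subseteq> \<pi> t ` Omega M" using s p(2) by (auto simp: m_subsets_def)
      then obtain r where r: "r \<subseteq> Omega M" "s = \<pi> t ` r" by (metis subset_imageE)
      have i: "inj_on (\<pi> t) r" using inj_on_subset[OF p(1) r(1)] .
      have "r \<in> m_subsets m M" using s r i unfolding m_subsets_def by (auto simp: card_image finite_image_iff)
      then show ?thesis using r by blast
    qed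
    ultimately show ?thesis unfolding bij_betw_def by blast
  qed
  have "bij_betw (\<lambda>t'. ?\<phi> (up t') t') {t'\<in>pverts T. up t' = t} (m_subsets m M)" if t: "t \<in> pverts T" for t
  proof -
    have "{t'. (t', t) \<in> parcs T} = {t'\<in>pverts T. up t' = t}" using arc by auto
    then have "bij_betw ((`) (\<pi> t) \<circ> \<phi> t) {t'\<in>pverts T. up t' = t} (m_subsets m M)"
      using bij_betw_trans[OF bij[OF t] im[OF t]] by simp
    then show ?thesis by (rule iffD1[OF bij_betw_cong, rotated]) auto
  qed
  moreover have "?\<phi> (up ((up ^^ i) a)) ((up ^^ i) a) = s0" for i
    using \<pi>0[OF pV[OF a], of "Suc i" i] by simp
  ultimately have "based_tree (pverts T) up (\<lambda>t. ?\<phi> (up t) t) (m_subsets m M) a s0"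
    unfolding based_tree_def using up acyc confl a by blast
  with D_digraph_relabel[where \<pi> = \<pi>, OF T \<pi>] show ?thesis using arcs by (rule that)
qed

lemma D_digraph_unique:
  assumes T: "labelled_regular_tree m M T \<phi>" and T': "labelled_regular_tree m M T' \<phi>'"
    and "enat m \<le> M"
  shows "\<exists>f. dg_isom f (with_proj (D_digraph M T \<phi>)) (with_proj (D_digraph M T' \<phi>'))"
proof -
  have "enat i < M" if "i < m" for i
    using assms(3) that by (metis enat_ord_simps(2) less_le_trans)
  \<comment> \<open>Any \<open>m\<close>-subset would serve, provided that it is the same for both
    trees; this one exists because \<open>m\<close> is at most \<open>M\<close>.\<close>
  then have s0: "{..<m} \<in> m_subsets m M" unfolding m_subsets_def Omega_def by auto
  obtain \<psi> up a f where f: "dg_isom f (with_proj (D_digraph M T \<phi>)) (with_proj (D_digraph M T \<psi>))"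
    and B: "based_tree (pverts T) up (\<lambda>t. \<psi> (up t) t) (m_subsets m M) a {..<m}"
    and arc: "\<forall>s t. (s, t) \<in> parcs T \<longleftrightarrow> s \<in> pverts T \<and> t = up s"
    using labelled_regular_tree_based[OF T s0] .
  obtain \<psi>' up' a' f' where f': "dg_isom f' (with_proj (D_digraph M T' \<phi>')) (with_proj (D_digraph M T' \<psi>'))"
    and B': "based_tree (pverts T') up' (\<lambda>t. \<psi>' (up' t) t) (m_subsets m M) a' {..<m}"
    and arc': "\<forall>s t. (s, t) \<in> parcs T' \<longleftrightarrow> s \<in> pverts T' \<and> t = up' s"
    using labelled_regular_tree_based[OF T' s0] .
  obtain h where h: "bij_betw h (pverts T) (pverts T')"
    and hup: "\<forall>v\<in>pverts T. h (up v) = up' (h v)"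
    and hlab: "\<forall>v\<in>pverts T. \<psi>' (up' (h v)) (h v) = \<psi> (up v) v"
    using based_tree_iso[OF B B'] .
  have up_V: "up t \<in> pverts T" if "t \<in> pverts T" for t using B that unfolding based_tree_def by blast
  have hV: "h t \<in> pverts T'" if "t \<in> pverts T" for t using h that by (auto simp: bij_betw_def)
  have hinj: "h s = h t \<longleftrightarrow> s = t" if "s \<in> pverts T" "t \<in> pverts T" for s t
    using h that by (auto simp: bij_betw_def inj_on_def)
  let ?g = "map_prod h id :: _ \<times> nat \<Rightarrow> _"
  have "bij_betw ?g (pverts T \<times> Omega M) (pverts T' \<times> Omega M)"
    by (rule bij_betw_map_prod[OF h bij_betw_id])
  moreover have "(u, v) \<in> parcs (D_digraph M T \<psi>) \<longleftrightarrow> (?g u, ?g v) \<in> parcs (D_digraph M T' \<psi>')"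
    if uv: "u \<in> pverts T \<times> Omega M" "v \<in> pverts T \<times> Omega M" for u v
  proof -
    obtain s c t b where e: "u = (s, c)" "v = (t, b)" by (cases u, cases v)
    have V: "s \<in> pverts T" "t \<in> pverts T" using uv e by auto
    have "t = up s \<longleftrightarrow> h t = up' (h s)" using hinj[OF V(2) up_V[OF V(1)]] bspec[OF hup V(1)] by simp
    moreover have "b \<in> \<psi> t s \<longleftrightarrow> b \<in> \<psi>' (h t) (h s)" if "t = up s"
      using bspec[OF hlab V(1)] bspec[OF hup V(1)] that by simp
    ultimately show ?thesis unfolding e D_digraph_def using V hV arc arc' by auto
  qed
  ultimately have "dg_isom ?g (with_proj (D_digraph M T \<psi>)) (with_proj (D_digraph M T' \<psi>'))"
    unfolding dg_isom_def by (simp add: D_digraph_def)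
  then show ?thesis using dg_isom_trans[OF dg_isom_trans[OF f] dg_isom_sym[OF f']] by blast
qed

context acyclic_homogeneous_digraph
begin

section \<open>The quotient by delta\<close>

lemma delta_refl: "v \<in> pverts D \<Longrightarrow> (v, v) \<in> delta D"
  by (simp add: delta_def)

lemma delta_class_eq_iff:
  assumes "u \<in> pverts D" "v \<in> pverts D"
  shows "delta D `` {u} = delta D `` {v} \<longleftrightarrow> (u, v) \<in> delta D"
  using eq_equiv_class_iff[OF equiv_delta assms] .

lemma delta_class_of_mem:
  assumes "A \<in> pverts D // delta D" "a \<in> A"
  shows "A = delta D `` {a}" "a \<in> pverts D"
proof -
  obtain v where v: "v \<in> pverts D" "A = delta D `` {v}" using assms(1) by (rule quotientE)
  then have "(v, a) \<in> delta D" using assms(2) by simp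
  then show "A = delta D `` {a}" "a \<in> pverts D"
    using v delta_class_eq_iff delta_in_pverts(2) by auto
qed

lemma pverts_quotient: "A \<in> pverts (delta_quotient D) \<longleftrightarrow> (\<exists>v\<in>pverts D. A = delta D `` {v})"
  by (auto simp: delta_quotient_def quotient_def)

lemma parcs_quotient:
  "(A, B) \<in> parcs (delta_quotient D) \<longleftrightarrow>
     (\<exists>u v. (u, v) \<in> parcs D \<and> A = delta D `` {u} \<and> B = delta D `` {v})"
proof
  assume "(A, B) \<in> parcs (delta_quotient D)"
  then obtain a b where "A \<in> pverts D // delta D" "B \<in> pverts D // delta D" "a \<in> A" "b \<in> B" "(a, b) \<in> parcs D"
    unfolding delta_quotient_def by auto
  then show "\<exists>u v. (u, v) \<in> parcs D \<and> A = delta D `` {u} \<and> B = delta D `` {v}"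
    using delta_class_of_mem by metis
next
  assume "\<exists>u v. (u, v) \<in> parcs D \<and> A = delta D `` {u} \<and> B = delta D `` {v}"
  then obtain u v where uv: "(u, v) \<in> parcs D" and AB: "A = delta D `` {u}" "B = delta D `` {v}" by blast
  note V = parcs_in_pverts[OF uv]
  have "u \<in> A" "v \<in> B" using delta_refl V AB by auto
  moreover have "A \<in> pverts D // delta D" "B \<in> pverts D // delta D" unfolding AB using V by (auto intro: quotientI)
  ultimately show "(A, B) \<in> parcs (delta_quotient D)" unfolding delta_quotient_def using uv by auto
qed

lemma out_neighbours_delta_class:
  assumes "u \<in> pverts D"
  shows "parcs D `` (delta D `` {u}) = parcs D `` {u}"
  using assms by (auto simp: delta_def)

text \<open>Paths of the quotient lift to \<open>D\<close> from any prescribed vertex of the first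
  class, since the vertices of a class have the same out-neighbours. A cycle would lift to a path
  from a vertex back into its own class, against \<open>delta_not_desc\<close>.\<close>

lemma acyclic_quotient: "acyclic (parcs (delta_quotient D))"
proof -
  have succ: "\<exists>b\<in>B. (a, b) \<in> parcs D" if AB: "(A, B) \<in> parcs (delta_quotient D)" "a \<in> A" for A B a
  proof -
    obtain u v where uv: "(u, v) \<in> parcs D" "A = delta D `` {u}" "B = delta D `` {v}"
      using AB(1) unfolding parcs_quotient by blast
    then have "(a, v) \<in> parcs D" using AB(2) by (auto simp: delta_def)
    moreover have "v \<in> B" using uv delta_refl parcs_in_pverts(2) by blast
    ultimately show ?thesis by blast
  qed
  have path: "\<exists>b\<in>B. (a, b) \<in> (parcs D)\<^sup>+" if "(A, B) \<in> (parcs (delta_quotient D))\<^sup>+" "a \<in> A" for A B a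
    using that(1)
  proof (induction rule: trancl_induct)
    case (base B)
    then show ?case using succ[OF _ that(2)] by blast
  next
    case (step B C)
    then obtain b where b: "b \<in> B" "(a, b) \<in> (parcs D)\<^sup>+" by blast
    obtain c where "c \<in> C" "(b, c) \<in> parcs D" using succ[OF step(2) b(1)] by blast
    then show ?case using b(2) by (meson trancl.trancl_into_trancl)
  qed
  have "(A, A) \<notin> (parcs (delta_quotient D))\<^sup>+" for A
  proof
    assume A: "(A, A) \<in> (parcs (delta_quotient D))\<^sup>+"
    then obtain B where "(A, B) \<in> parcs (delta_quotient D)" by (meson tranclD)
    then obtain u where u: "u \<in> pverts D" "A = delta D `` {u}"
      using parcs_in_pverts(1) unfolding parcs_quotient by blast
    then obtain b where "(u, b) \<in> delta D" "(u, b) \<in> (parcs D)\<^sup>+"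
      using path[OF A, of u] delta_refl by blast
    then show False using delta_not_desc by blast
  qed
  then show ?thesis unfolding acyclic_def by blast
qed

lemma pair_wf_quotient: "pair_wf_digraph (delta_quotient D)"
  by unfold_locales (auto simp: delta_quotient_def)

lemma connected_quotient: "connected (with_proj (delta_quotient D))"
  unfolding connected_iff_rtrancl[OF pair_wf_quotient]
proof (intro conjI ballI)
  show "pverts (delta_quotient D) \<noteq> {}"
    using pverts_nonempty pverts_quotient by blast
  fix A B assume "A \<in> pverts (delta_quotient D)" "B \<in> pverts (delta_quotient D)"
  then obtain u v where V: "u \<in> pverts D" "v \<in> pverts D" and AB: "A = delta D `` {u}" "B = delta D `` {v}"
    unfolding pverts_quotient by blast
  have "(u, v) \<in> (parcs D \<union> (parcs D)\<inverse>)\<^sup>*"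
    using connected V connected_iff_rtrancl[OF pair_wf_digraph_axioms] by blast
  then show "(A, B) \<in> (parcs (delta_quotient D) \<union> (parcs (delta_quotient D))\<inverse>)\<^sup>*"
    unfolding AB
  proof (induction rule: rtrancl_induct)
    case base
    then show ?case by blast
  next
    case (step y z)
    then have "(delta D `` {y}, delta D `` {z}) \<in> parcs (delta_quotient D) \<union> (parcs (delta_quotient D))\<inverse>"
      by (auto simp: parcs_quotient)
    then show ?case using step.IH by (rule rtrancl.rtrancl_into_rtrancl[rotated])
  qed
qed

lemma quotient_arc_from:
  assumes sub: "cosink \<subseteq> delta D" and uv: "(u, v) \<in> parcs D"
  shows "(delta D `` {u}, B) \<in> parcs (delta_quotient D) \<longleftrightarrow> B = delta D `` {v}"
proof
  assume "(delta D `` {u}, B) \<in> parcs (delta_quotient D)"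
  then obtain u' v' where u': "(u', v') \<in> parcs D" "delta D `` {u} = delta D `` {u'}" "B = delta D `` {v'}"
    unfolding parcs_quotient by blast
  then have "(u, u') \<in> delta D" using delta_class_eq_iff parcs_in_pverts(1) uv by blast
  then have "(u, v') \<in> parcs D" using u'(1) by (auto simp: delta_def)
  then have "(v, v') \<in> delta D" using out_neighbours_cosink[OF uv] sub by blast
  then show "B = delta D `` {v}" using u'(3) delta_class_eq_iff delta_in_pverts by blast
qed (use uv parcs_quotient in blast)

lemma quotient_tree:
  assumes sub: "cosink \<subseteq> delta D"
  shows "directed_tree (delta_quotient D)" "has_out_valency (delta_quotient D) 1"
proof -
  let ?Q = "delta_quotient D"
  have irr: "(A, A) \<notin> (parcs ?Q)\<^sup>+" for A using acyclic_quotient unfolding acyclic_def by blast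
  have "single_valued (parcs ?Q)"
  proof (rule single_valuedI)
    fix A B C assume AB: "(A, B) \<in> parcs ?Q" and AC: "(A, C) \<in> parcs ?Q"
    then obtain u v where "(u, v) \<in> parcs D" "A = delta D `` {u}" unfolding parcs_quotient by blast
    then show "B = C" using quotient_arc_from[OF sub] AB AC by metis
  qed
  then have nocyc: "\<nexists>xs. undirected_cycle ?Q xs" using no_undirected_cycle[OF _ acyclic_quotient] by blast
  have loopfree: "pair_loopfree_digraph ?Q"
  proof -
    interpret Q: pair_wf_digraph ?Q by (rule pair_wf_quotient)
    show ?thesis
    proof
      show "fst e \<noteq> snd e" if "e \<in> parcs ?Q" for e
        using that irr[of "fst e"] by (metis prod.collapse trancl.r_into_trancl)
    qed
  qed
  have "(B, A) \<notin> parcs ?Q" if "(A, B) \<in> parcs ?Q" for A B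
    using that irr[of A] by (meson trancl.simps)
  then show "directed_tree ?Q"
    unfolding directed_tree_def using loopfree connected_quotient nocyc by blast
  show "has_out_valency ?Q 1"
    unfolding has_out_valency_def
  proof
    fix A assume "A \<in> pverts ?Q"
    then obtain u where u: "u \<in> pverts D" "A = delta D `` {u}" unfolding pverts_quotient by blast
    obtain v where v: "(u, v) \<in> parcs D" using ex_out_neighbour[OF u(1)] .
    have "out_arcs (with_proj ?Q) A = {(A, delta D `` {v})}"
      using quotient_arc_from[OF sub v] unfolding out_arcs_def u(2) by auto
    then show "finite (out_arcs (with_proj ?Q) A) \<and> out_degree (with_proj ?Q) A = 1"
      by (simp add: out_degree_def)
  qed
qed

section \<open>Reachability classes\<close>

lemma reach_class_of_mem:
  assumes "C \<in> parcs D // edge_reach D" "e \<in> C"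
  shows "C = edge_reach D `` {e}" "e \<in> parcs D"
proof -
  obtain e' where e': "e' \<in> parcs D" "C = edge_reach D `` {e'}" using assms(1) by (rule quotientE)
  then have "(e', e) \<in> edge_reach D" using assms(2) by simp
  then show "C = edge_reach D `` {e}" "e \<in> parcs D"
    using e'(2) edge_reach_arcs equiv_class_eq[OF equiv_edge_reach[OF acyclic]] by metis+
qed

lemma reach_class_nonempty:
  assumes "C \<in> parcs D // edge_reach D"
  obtains u y where "(u, y) \<in> C"
  using in_quotient_imp_non_empty[OF equiv_edge_reach[OF acyclic] assms] by auto

lemma reach_class_coincident:
  assumes C: "C \<in> parcs D // edge_reach D" and e: "e \<in> C" "e' \<in> parcs D" "fst e = fst e' \<or> snd e = snd e'"
  shows "e' \<in> C"
  using coincident_edge_reach[OF acyclic reach_class_of_mem(2)[OF C e(1)] e(2,3)] reach_class_of_mem(1)[OF C e(1)]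
  by blast

lemma reach_class_out:
  assumes C: "C \<in> parcs D // edge_reach D" and x: "x \<in> fst ` C"
  shows "C `` {x} = parcs D `` {x}"
proof -
  obtain y where xy: "(x, y) \<in> C" using x by auto
  have "(x, z) \<in> C \<longleftrightarrow> (x, z) \<in> parcs D" for z
    using reach_class_of_mem(2)[OF C, of "(x, z)"] reach_class_coincident[OF C xy, of "(x, z)"] by auto
  then show ?thesis by blast
qed

lemma reach_class_sinks:
  assumes C: "C \<in> parcs D // edge_reach D" and y: "y \<in> snd ` C"
  shows "snd ` C = cosink `` {y}"
proof -
  obtain u where u: "(u, y) \<in> C" using y by auto
  note uD = reach_class_of_mem[OF C u]
  have "z \<in> snd ` C \<longleftrightarrow> (y, z) \<in> cosink" for z
  proof
    assume "z \<in> snd ` C"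
    then obtain v where "(v, z) \<in> C" by auto
    then show "(y, z) \<in> cosink" using uD(1) unfolding cosink_def by blast
  next
    assume yz: "(y, z) \<in> cosink"
    then obtain v where v: "(v, z) \<in> parcs D" using cosink_in_pverts ex_in_neighbour by metis
    then have "(v, z) \<in> C" using cosink_iff[OF uD(2) v] yz uD(1) by blast
    then show "z \<in> snd ` C" by force
  qed
  then show ?thesis by blast
qed

text \<open>The delta-class of \<open>y\<close> is the whole sink set of \<open>C\<close>, so every
  arc into it belongs to \<open>C\<close>. Several sources may give the same class, which is why the
  in-valency counts delta-classes of sources.\<close>

lemma quotient_in_neighbours:
  assumes eq: "delta D = cosink" and C: "C \<in> parcs D // edge_reach D" and y: "y \<in> snd ` C"
  shows "{A. (A, delta D `` {y}) \<in> parcs (delta_quotient D)} = {delta D `` {x} | x. x \<in> fst ` C}"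
proof -
  have Y: "snd ` C = delta D `` {y}" using reach_class_sinks[OF C y] eq by simp
  obtain u where u: "(u, y) \<in> C" using y by auto
  note yV = parcs_in_pverts(2)[OF reach_class_of_mem(2)[OF C u]]
  show ?thesis
  proof (intro equalityI subsetI)
    fix A assume "A \<in> {A. (A, delta D `` {y}) \<in> parcs (delta_quotient D)}"
    then obtain a b where ab: "(a, b) \<in> parcs D" "A = delta D `` {a}" "delta D `` {y} = delta D `` {b}"
      unfolding parcs_quotient by blast
    then have "b \<in> snd ` C" using Y delta_refl parcs_in_pverts(2) by blast
    then obtain a' where "(a', b) \<in> C" by auto
    then have "(a, b) \<in> C" using reach_class_coincident[OF C] ab(1) by force
    then show "A \<in> {delta D `` {x} | x. x \<in> fst ` C}" using ab(2) by force
  next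
    fix A assume "A \<in> {delta D `` {x} | x. x \<in> fst ` C}"
    then obtain x b where xb: "(x, b) \<in> C" "A = delta D `` {x}" by auto
    note xbD = reach_class_of_mem(2)[OF C xb(1)]
    have "b \<in> snd ` C" using xb(1) by force
    then have "(y, b) \<in> delta D" using Y by blast
    then have "delta D `` {y} = delta D `` {b}" using delta_class_eq_iff delta_in_pverts by blast
    then show "A \<in> {A. (A, delta D `` {y}) \<in> parcs (delta_quotient D)}"
      using xbD xb(2) unfolding parcs_quotient by blast
  qed
qed

lemma reach_class_at_sink:
  assumes "y \<in> pverts D"
  obtains C where "C \<in> parcs D // edge_reach D" "y \<in> snd ` C"
proof -
  obtain u where u: "(u, y) \<in> parcs D" using ex_in_neighbour[OF assms] .
  have "(u, y) \<in> edge_reach D `` {(u, y)}" using coincident_edge_reach[OF acyclic u u] by simp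
  then have "y \<in> snd ` (edge_reach D `` {(u, y)})" by force
  then show ?thesis using that quotientI[OF u] by metis
qed

text \<open>An automorphism that carries one tail of \<open>C\<close> to a tail of \<open>C'\<close>
  maps all of \<open>C\<close> into \<open>C'\<close>, because arcs with a common tail lie in one
  class; it also maps delta-classes to delta-classes. Used in both directions, the inequality shows
  that \<open>k\<close> does not depend on the alternet.\<close>

lemma card_source_classes_le:
  assumes C: "C \<in> parcs D // edge_reach D" "C' \<in> parcs D // edge_reach D" and fin: "finite (fst ` C')"
  shows "card {delta D `` {x} | x. x \<in> fst ` C} \<le> card {delta D `` {x} | x. x \<in> fst ` C'}"
proof -
  obtain u y where uy: "(u, y) \<in> C" using reach_class_nonempty[OF C(1)] .
  obtain v z where vz: "(v, z) \<in> C'" using reach_class_nonempty[OF C(2)] .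
  note uD = reach_class_of_mem[OF C(1) uy] and vD = reach_class_of_mem[OF C(2) vz]
  obtain g where g: "automorphism D g" "g u = v"
    using vertex_transitiveE[OF parcs_in_pverts(1)[OF uD(2)] parcs_in_pverts(1)[OF vD(2)]] .
  have sV: "fst ` C \<subseteq> pverts D" using reach_class_of_mem(2)[OF C(1)] parcs_in_pverts(1) by force
  have "g x \<in> fst ` C'" if x: "x \<in> fst ` C" for x
  proof -
    obtain b where "(x, b) \<in> C" using x by auto
    then have "((u, y), (x, b)) \<in> edge_reach D" using uD(1) by blast
    then have r: "((v, g y), (g x, g b)) \<in> edge_reach D"
      using automorphism_edge_reach[OF acyclic g(1)] g(2) by fastforce
    have "(v, g y) \<in> C'" using reach_class_coincident[OF C(2) vz] edge_reach_arcs[OF r] by simp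
    then have "(g x, g b) \<in> C'" using reach_class_of_mem(1)[OF C(2)] r by blast
    then show ?thesis by force
  qed
  then have sub: "(`) g ` {delta D `` {x} | x. x \<in> fst ` C} \<subseteq> {delta D `` {x} | x. x \<in> fst ` C'}"
    using automorphism_delta_class[OF g(1), symmetric] sV by (smt (verit) image_subsetI mem_Collect_eq subsetD)
  have "inj_on g (pverts D)" using g(1) unfolding automorphism_iff bij_betw_def by blast
  then have "inj_on ((`) g) {delta D `` {x} | x. x \<in> fst ` C}"
    by (rule inj_on_subset[OF inj_on_image_Pow]) (auto simp: delta_def)
  moreover have "finite {delta D `` {x} | x. x \<in> fst ` C'}"
    using fin by (simp add: setcompr_eq_image)
  ultimately show ?thesis using card_inj_on_le[OF _ sub] by blast
qed

section \<open>Alternets in the class C\<close>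

text \<open>Translates \<open>class_C\<close> from the alternet to \<open>D\<close>. A source has
  all its out-neighbours inside the alternet, and a vertex delta-equivalent to it is again a source,
  so its delta-class is the same in both digraphs.\<close>

lemma class_C_reach_class:
  assumes C: "C \<in> parcs D // edge_reach D" and cl: "class_C (spanned_by C)"
  shows "finite (fst ` C)" "finite (snd ` C)"
    "\<And>x. x \<in> fst ` C \<Longrightarrow> card (delta D `` {x}) = card (snd ` C)"
    "delta_nontrivial_on D (pverts D)"
proof -
  obtain X Y where XY': "pverts (spanned_by C) = X \<union> Y" "X \<inter> Y = {}" "parcs (spanned_by C) \<subseteq> X \<times> Y"
    and fin: "finite X" "finite Y" and nt: "delta_nontrivial_on (spanned_by C) X"
    and card: "\<forall>x\<in>X. card {x'\<in>X. (x, x') \<in> delta (spanned_by C)} = card Y"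
    using cl unfolding class_C_def by blast
  have XY: "fst ` C \<union> snd ` C = X \<union> Y" "X \<inter> Y = {}" "C \<subseteq> X \<times> Y"
    using XY' by (simp_all add: spanned_by_def)
  have sub: "fst ` C \<subseteq> X" "snd ` C \<subseteq> Y" using XY(3) by auto
  \<comment> \<open>The disjoint sets \<open>X\<close> and \<open>Y\<close> contain the tails and
    the heads respectively, and together contain nothing else, so they are the sets of tails and
    heads.\<close>
  have "X = A \<and> Y = B" if "A \<union> B = X \<union> Y" "A \<subseteq> X" "B \<subseteq> Y" for A B using that XY(2) by blast
  from this[OF XY(1) sub] have X: "X = fst ` C" and Y: "Y = snd ` C" by simp_all
  have sV: "X \<subseteq> pverts D" unfolding X using reach_class_of_mem(2)[OF C] parcs_in_pverts(1) by force
  have d: "(x, x') \<in> delta (spanned_by C) \<longleftrightarrow> (x, x') \<in> delta D" if "x \<in> X" "x' \<in> X" for x x'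
  proof -
    have "x \<in> pverts D" "x' \<in> pverts D" using sV that by blast+
    moreover have "C `` {x} = parcs D `` {x}" "C `` {x'} = parcs D `` {x'}"
      using reach_class_out[OF C] that X by blast+
    ultimately show ?thesis unfolding delta_def spanned_by_def using that X by auto
  qed
  have "x' \<in> X" if x: "x \<in> X" and xx': "(x, x') \<in> delta D" for x x'
  proof -
    obtain y where xy: "(x, y) \<in> C" using x X by auto
    then have "(x', y) \<in> parcs D" using reach_class_of_mem(2)[OF C xy] xx' by (auto simp: delta_def)
    then have "(x', y) \<in> C" using reach_class_coincident[OF C xy] by simp
    then show ?thesis using X by force
  qed
  then have "{x'\<in>X. (x, x') \<in> delta (spanned_by C)} = delta D `` {x}" if "x \<in> X" for x
    using d that by blast
  then show "\<And>x. x \<in> fst ` C \<Longrightarrow> card (delta D `` {x}) = card (snd ` C)" using card X Y by metis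
  show "finite (fst ` C)" "finite (snd ` C)" using fin X Y by auto
  show "delta_nontrivial_on D (pverts D)" using nt d sV unfolding delta_nontrivial_on_def by blast
qed

text \<open>All delta-classes have the same size. Measured at a source of \<open>C\<close> it is the
  number of sinks of \<open>C\<close>; hence the delta-class of a sink, which is contained in the
  sink set, fills this finite set.\<close>

lemma class_C_delta_eq_cosink:
  assumes cl: "\<forall>A\<in>alternets D. class_C A"
  shows "delta D = cosink"
proof -
  have cl': "class_C (spanned_by C)" if "C \<in> parcs D // edge_reach D" for C
    using cl that unfolding alternets_def by blast
  have "(y, z) \<in> delta D \<longleftrightarrow> (y, z) \<in> cosink" if y: "y \<in> pverts D" for y z
  proof -
    obtain C where C: "C \<in> parcs D // edge_reach D" "y \<in> snd ` C" using reach_class_at_sink[OF y] .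
    note cC = class_C_reach_class[OF C(1) cl'[OF C(1)]]
    have s: "snd ` C = cosink `` {y}" using reach_class_sinks[OF C] .
    obtain x b where xb: "(x, b) \<in> C" using reach_class_nonempty[OF C(1)] .
    have xV: "x \<in> pverts D" using reach_class_of_mem(2)[OF C(1) xb] parcs_in_pverts(1) by blast
    obtain g where g: "automorphism D g" "g x = y" using vertex_transitiveE[OF xV y] .
    have "inj_on g (pverts D)" using g(1) unfolding automorphism_iff bij_betw_def by blast
    then have "inj_on g (delta D `` {x})" by (rule inj_on_subset) (auto simp: delta_def)
    then have "card (delta D `` {y}) = card (delta D `` {x})"
      using automorphism_delta_class[OF g(1) xV] g(2) card_image by metis
    also have "\<dots> = card (cosink `` {y})" using cC(3)[of x] xb s by force
    finally have "card (delta D `` {y}) = card (cosink `` {y})" .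
    moreover have "delta D `` {y} \<subseteq> cosink `` {y}" using delta_imp_cosink[OF cC(4)] by blast
    moreover have "finite (cosink `` {y})" using cC(2) s by simp
    ultimately have "delta D `` {y} = cosink `` {y}" by (metis card_subset_eq)
    then show ?thesis by blast
  qed
  then show ?thesis using delta_in_pverts(1) cosink_in_pverts(1) by auto
qed

lemma class_C_quotient:
  assumes cl: "\<forall>A\<in>alternets D. class_C A"
  shows "delta_nontrivial_on D (pverts D)" "directed_tree (delta_quotient D)"
    "has_out_valency (delta_quotient D) 1"
    "\<exists>k. has_in_valency (delta_quotient D) k \<and>
       (\<forall>A\<in>alternets D. card {delta D `` {x} | x. x \<in> sources A} = k)"
proof -
  have cl': "class_C (spanned_by C)" if "C \<in> parcs D // edge_reach D" for C
    using cl that unfolding alternets_def by blast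
  have fin: "finite (fst ` C)" if "C \<in> parcs D // edge_reach D" for C
    using class_C_reach_class(1)[OF that cl'[OF that]] .
  obtain v where v: "v \<in> pverts D" using pverts_nonempty by blast
  obtain C0 where C0: "C0 \<in> parcs D // edge_reach D" using reach_class_at_sink[OF v] .
  show "delta_nontrivial_on D (pverts D)" using class_C_reach_class(4)[OF C0 cl'[OF C0]] .
  have eq: "delta D = cosink" using class_C_delta_eq_cosink[OF cl] .
  then show "directed_tree (delta_quotient D)" "has_out_valency (delta_quotient D) 1"
    using quotient_tree by simp_all
  define k where "k = card {delta D `` {x} | x. x \<in> fst ` C0}"
  have k: "card {delta D `` {x} | x. x \<in> fst ` C} = k" if "C \<in> parcs D // edge_reach D" for C
    unfolding k_def using card_source_classes_le[OF that C0 fin[OF C0]] card_source_classes_le[OF C0 that fin[OF that]]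
    by simp
  have "has_in_valency (delta_quotient D) k"
    unfolding has_in_valency_def
  proof
    fix B assume "B \<in> pverts (delta_quotient D)"
    then obtain y where y: "y \<in> pverts D" "B = delta D `` {y}" unfolding pverts_quotient by blast
    obtain C where C: "C \<in> parcs D // edge_reach D" "y \<in> snd ` C" using reach_class_at_sink[OF y(1)] .
    have "in_arcs (with_proj (delta_quotient D)) B = (\<lambda>A. (A, B)) ` {A. (A, B) \<in> parcs (delta_quotient D)}"
      by (auto simp: in_arcs_def)
    also have "\<dots> = (\<lambda>A. (A, B)) ` {delta D `` {x} | x. x \<in> fst ` C}"
      using quotient_in_neighbours[OF eq C] y(2) by simp
    finally have in_eq: "in_arcs (with_proj (delta_quotient D)) B = (\<lambda>A. (A, B)) ` {delta D `` {x} | x. x \<in> fst ` C}" .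
    have "inj_on (\<lambda>A. (A, B)) {delta D `` {x} | x. x \<in> fst ` C}" by (simp add: inj_on_def)
    then have "card (in_arcs (with_proj (delta_quotient D)) B) = k" unfolding in_eq using k[OF C(1)] by (simp add: card_image)
    moreover have "finite {delta D `` {x} | x. x \<in> fst ` C}" using fin[OF C(1)] by (simp add: setcompr_eq_image)
    then have "finite (in_arcs (with_proj (delta_quotient D)) B)" unfolding in_eq by (rule finite_imageI)
    ultimately show "finite (in_arcs (with_proj (delta_quotient D)) B) \<and> in_degree (with_proj (delta_quotient D)) B = k"
      by (simp add: in_degree_def)
  qed
  moreover have "card {delta D `` {x} | x. x \<in> sources A} = k" if "A \<in> alternets D" for A
    using that k unfolding alternets_def sources_def spanned_by_def by auto
  ultimately show "\<exists>k. has_in_valency (delta_quotient D) k \<and>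
       (\<forall>A\<in>alternets D. card {delta D `` {x} | x. x \<in> sources A} = k)" by blast
qed

end

section \<open>Alternets isomorphic to Sigma(m,M)\<close>

lemma pair_wf_spanned_by: "pair_wf_digraph (spanned_by C)"
  by unfold_locales (auto simp: spanned_by_def)

lemma pair_wf_Sigma: "pair_wf_digraph (Sigma_digraph m M)"
  by unfold_locales (auto simp: Sigma_digraph_def m_subsets_def)

lemma pair_wf_D_digraph:
  assumes "labelled_regular_tree m M T \<phi>"
  shows "pair_wf_digraph (D_digraph M T \<phi>)"
proof -
  interpret T: pair_loopfree_digraph T
    using assms unfolding labelled_regular_tree_def directed_tree_def by blast
  have "a \<in> Omega M" if e: "(t', t) \<in> parcs T" and a: "a \<in> \<phi> t t'" for t t' a
  proof -
    have "bij_betw (\<phi> t) {t'. (t', t) \<in> parcs T} (m_subsets m M)"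
      using assms T.parcs_in_pverts(2)[OF e] unfolding labelled_regular_tree_def by blast
    then have "\<phi> t t' \<in> m_subsets m M" using e by (auto simp: bij_betw_def)
    then show ?thesis using a by (auto simp: m_subsets_def)
  qed
  then show ?thesis using T.parcs_in_pverts by unfold_locales (auto simp: D_digraph_def)
qed

text \<open>The initial segment \<open>{..<m}\<close> supplies enough elements to fill
  \<open>Z\<close> up to size \<open>m\<close>.\<close>

lemma m_subset_extend:
  assumes "Z \<subseteq> Omega M" "finite Z" "card Z \<le> m" "enat m \<le> M"
  obtains s where "s \<in> m_subsets m M" "Z \<subseteq> s"
proof -
  have "enat i < M" if "i < m" for i
    using assms(4) that by (metis enat_ord_simps(2) less_le_trans)
  then have sub: "Z \<union> {..<m} \<subseteq> Omega M" using assms(1) by (auto simp: Omega_def)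
  have "card {..<m} \<le> card (Z \<union> {..<m})" by (rule card_mono) (use assms(2) in auto)
  then have le: "m \<le> card (Z \<union> {..<m})" by simp
  have fin: "finite (Z \<union> {..<m})" using assms(2) by simp
  obtain s where s: "Z \<subseteq> s" "s \<subseteq> Z \<union> {..<m}" "card s = m"
    using exists_subset_between[OF assms(3) le Un_upper1 fin] by blast
  have "finite s" using s(2) fin by (rule finite_subset)
  then have "s \<in> m_subsets m M" using s sub unfolding m_subsets_def by auto
  then show ?thesis using that s(1) by blast
qed

context acyclic_homogeneous_digraph
begin

text \<open>The last conclusion comes from the sources \<open>(s, i)\<close> with
  \<open>i < m\<close>, which share the out-neighbourhood \<open>s\<close>. Exactly \<open>m\<close>
  of them are collected, even if the delta-class is infinite, because a set of this size can be
  realised as an out-neighbourhood.\<close>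

lemma Sigma_reach_class:
  assumes C: "C \<in> parcs D // edge_reach D" and mM: "enat m \<le> M"
    and iso: "digraph_iso (with_proj (spanned_by C)) (with_proj (Sigma_digraph m M))"
  obtains \<beta> where "bij_betw \<beta> (snd ` C) (Omega M)"
    "(\<lambda>x. \<beta> ` (parcs D `` {x})) ` fst ` C = m_subsets m M"
    "\<forall>x\<in>fst ` C. \<exists>Z\<subseteq>delta D `` {x}. finite Z \<and> card Z = m"
proof -
  let ?S = "m_subsets m M" and ?W = "fst ` C \<union> snd ` C"
  obtain f where f: "bij_betw f ?W (Inl ` (?S \<times> Omega M) \<union> Inr ` Omega M)"
    and fe: "\<forall>u\<in>?W. \<forall>v\<in>?W. (u, v) \<in> C \<longleftrightarrow> (f u, f v) \<in> parcs (Sigma_digraph m M)"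
    using iso unfolding digraph_iso_iff[OF pair_wf_spanned_by pair_wf_Sigma] dg_isom_def
    by (auto simp: spanned_by_def Sigma_digraph_def)
  have arc: "(f u, f v) \<in> parcs (Sigma_digraph m M)" if "(u, v) \<in> C" for u v
  proof -
    have "u \<in> ?W" "v \<in> ?W" using that by force+
    then show ?thesis using fe that by blast
  qed
  have fsnd: "\<exists>a\<in>Omega M. f y = Inr a" if y: "y \<in> snd ` C" for y
  proof -
    obtain u where "(u, y) \<in> C" using y by auto
    from arc[OF this] show ?thesis by (auto simp: Sigma_digraph_def m_subsets_def)
  qed
  have ffst: "\<exists>s\<in>?S. \<exists>c\<in>Omega M. f x = Inl (s, c)" if x: "x \<in> fst ` C" for x
  proof -
    obtain v where "(x, v) \<in> C" using x by auto
    from arc[OF this] show ?thesis by (auto simp: Sigma_digraph_def)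
  qed
  have finj: "inj_on f ?W" and fim: "f ` ?W = Inl ` (?S \<times> Omega M) \<union> Inr ` Omega M"
    using f by (auto simp: bij_betw_def)
  have ex_sink: "\<exists>y\<in>snd ` C. f y = Inr a" if a: "a \<in> Omega M" for a
  proof -
    have "Inr a \<in> f ` ?W" unfolding fim using a by blast
    then obtain y where y: "y \<in> ?W" "f y = Inr a" by (metis imageE)
    then have "y \<notin> fst ` C" using ffst by fastforce
    then show ?thesis using y by blast
  qed
  have ex_source: "\<exists>x\<in>fst ` C. f x = Inl (s, c)" if "s \<in> ?S" "c \<in> Omega M" for s c
  proof -
    have "Inl (s, c) \<in> f ` ?W" unfolding fim using that by blast
    then obtain x where x: "x \<in> ?W" "f x = Inl (s, c)" by (metis imageE)
    then have "x \<notin> snd ` C" using fsnd by fastforce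
    then show ?thesis using x by blast
  qed
  define \<beta> where "\<beta> y = projr (f y)" for y
  have f\<beta>: "f y = Inr (\<beta> y)" "\<beta> y \<in> Omega M" if "y \<in> snd ` C" for y
    using fsnd[OF that] unfolding \<beta>_def by auto
  have \<beta>inj: "inj_on \<beta> (snd ` C)"
  proof (rule inj_onI)
    fix y z assume yz: "y \<in> snd ` C" "z \<in> snd ` C" "\<beta> y = \<beta> z"
    then have "f y = f z" using f\<beta> by simp
    then show "y = z" using inj_onD[OF finj] yz by blast
  qed
  have \<beta>: "bij_betw \<beta> (snd ` C) (Omega M)"
    unfolding bij_betw_def
  proof
    show "\<beta> ` snd ` C = Omega M"
    proof (intro equalityI subsetI)
      fix a assume "a \<in> Omega M"
      then obtain y where "y \<in> snd ` C" "f y = Inr a" using ex_sink by blast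
      then show "a \<in> \<beta> ` snd ` C" using f\<beta>(1) by force
    qed (use f\<beta>(2) in blast)
  qed (rule \<beta>inj)
  have out: "\<beta> ` (parcs D `` {x}) = s" if x: "x \<in> fst ` C" "f x = Inl (s, c)" for x s c
  proof -
    have sS: "s \<in> ?S" using ffst[OF x(1)] x(2) by auto
    have cO: "c \<in> Omega M" using ffst[OF x(1)] x(2) by auto
    have "\<beta> ` (C `` {x}) = s"
    proof (intro equalityI subsetI)
      fix a assume "a \<in> \<beta> ` (C `` {x})"
      then obtain y where y: "(x, y) \<in> C" "a = \<beta> y" by auto
      then have "y \<in> snd ` C" by force
      then show "a \<in> s" using arc[OF y(1)] f\<beta>(1) x(2) y(2) by (auto simp: Sigma_digraph_def)
    next
      fix a assume a: "a \<in> s"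
      then have "a \<in> Omega M" using sS by (auto simp: m_subsets_def)
      then obtain y where y: "y \<in> snd ` C" "f y = Inr a" using ex_sink by blast
      have "(f x, f y) \<in> parcs (Sigma_digraph m M)" unfolding x(2) y(2) Sigma_digraph_def using sS cO a by auto
      then have "(x, y) \<in> C" using fe x(1) y(1) by blast
      moreover have "\<beta> y = a" using f\<beta>(1)[OF y(1)] y(2) by simp
      ultimately show "a \<in> \<beta> ` (C `` {x})" by blast
    qed
    then show ?thesis using reach_class_out[OF C x(1)] by simp
  qed
  have lt: "i \<in> Omega M" if "i < m" for i
    using mM that unfolding Omega_def by (metis enat_ord_simps(2) less_le_trans mem_Collect_eq)
  have img: "(\<lambda>x. \<beta> ` (parcs D `` {x})) ` fst ` C = ?S"
  proof (intro equalityI subsetI)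
    fix s assume "s \<in> (\<lambda>x. \<beta> ` (parcs D `` {x})) ` fst ` C"
    then obtain x where x: "x \<in> fst ` C" "s = \<beta> ` (parcs D `` {x})" by blast
    then show "s \<in> ?S" using ffst[OF x(1)] out[OF x(1)] by metis
  next
    fix s assume s: "s \<in> ?S"
    obtain x where "x \<in> fst ` C" "f x = Inl (s, 0)"
      using ex_source[OF s lt[of 0]] out_valency(2) by auto
    then show "s \<in> (\<lambda>x. \<beta> ` (parcs D `` {x})) ` fst ` C" using out by blast
  qed
  have "\<exists>Z\<subseteq>delta D `` {x}. finite Z \<and> card Z = m" if x: "x \<in> fst ` C" for x
  proof -
    obtain s c where sc: "s \<in> ?S" "f x = Inl (s, c)" using ffst[OF x] by blast
    obtain g where g: "\<And>i. i < m \<Longrightarrow> g i \<in> fst ` C \<and> f (g i) = Inl (s, i)"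
      using ex_source[OF sc(1) lt] by metis
    have outsub: "parcs D `` {z} \<subseteq> snd ` C" if "z \<in> fst ` C" for z
      unfolding reach_class_out[OF C that, symmetric] by force
    have V: "z \<in> pverts D" if "z \<in> fst ` C" for z
      using that reach_class_of_mem(2)[OF C] parcs_in_pverts(1) by force
    have "(x, g i) \<in> delta D" if i: "i < m" for i
    proof -
      have gi: "g i \<in> fst ` C" "f (g i) = Inl (s, i)" using g[OF i] by auto
      have "\<beta> ` (parcs D `` {x}) = \<beta> ` (parcs D `` {g i})" using out[OF x sc(2)] out[OF gi] by simp
      then have "parcs D `` {x} = parcs D `` {g i}"
        using inj_on_image_eq_iff[OF \<beta>inj outsub[OF x] outsub[OF gi(1)]] by simp
      then show ?thesis unfolding delta_def using V[OF x] V[OF gi(1)] by simp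
    qed
    then have sub: "g ` {..<m} \<subseteq> delta D `` {x}" by auto
    have "inj_on g {..<m}"
    proof (rule inj_onI)
      fix i j assume "i \<in> {..<m}" "j \<in> {..<m}" "g i = g j"
      then have "Inl (s, i) = (Inl (s, j) :: (nat set \<times> nat) + nat)" using g by (metis lessThan_iff)
      then show "i = j" by simp
    qed
    then have "card (g ` {..<m}) = m" by (simp add: card_image)
    then show ?thesis using sub by blast
  qed
  then show ?thesis using that[OF \<beta> img] by blast
qed

section \<open>\<open>D\<close> as a copy of D(m,M) over its own quotient\<close>

context
  fixes M :: enat
  assumes mM: "enat m \<le> M"
    and iso: "\<forall>A\<in>alternets D. digraph_iso (with_proj A) (with_proj (Sigma_digraph m M))"
begin

lemma Sigma_alternet:
  assumes "C \<in> parcs D // edge_reach D"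
  obtains \<beta> where "bij_betw \<beta> (snd ` C) (Omega M)"
    "(\<lambda>x. \<beta> ` (parcs D `` {x})) ` fst ` C = m_subsets m M"
    "\<forall>x\<in>fst ` C. \<exists>Z\<subseteq>delta D `` {x}. finite Z \<and> card Z = m"
proof -
  have "spanned_by C \<in> alternets D" unfolding alternets_def using assms by (rule imageI)
  from Sigma_reach_class[OF assms mM bspec[OF iso this]] show ?thesis using that .
qed

text \<open>Every vertex has an out-neighbour and is thus a source of some alternet, so what holds
  for sources also holds at sinks.\<close>

lemma Sigma_delta_class_large:
  assumes y: "y \<in> pverts D"
  obtains Z where "Z \<subseteq> delta D `` {y}" "finite Z" "card Z = m"
proof -
  obtain z where z: "(y, z) \<in> parcs D" using ex_out_neighbour[OF y] .
  let ?C = "edge_reach D `` {(y, z)}"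
  have C: "?C \<in> parcs D // edge_reach D" using z by (rule quotientI)
  have "(y, z) \<in> ?C" using coincident_edge_reach[OF acyclic z z] by simp
  then have "y \<in> fst ` ?C" by force
  moreover obtain \<beta> where "\<forall>x\<in>fst ` ?C. \<exists>Z\<subseteq>delta D `` {x}. finite Z \<and> card Z = m"
    using Sigma_alternet[OF C] by metis
  ultimately show ?thesis using that by blast
qed

text \<open>Every \<open>m\<close>-set of sinks is the out-neighbourhood of some source. Some \<open>m\<close>-set of sinks lies in a
  single delta-class, so by vertex transitivity all of them do.\<close>

lemma Sigma_delta_eq_cosink: "delta D = cosink"
proof -
  have nontriv: "delta_nontrivial_on D (pverts D)"
  proof -
    obtain y where y: "y \<in> pverts D" using pverts_nonempty by blast
    obtain Z where Z: "Z \<subseteq> delta D `` {y}" "finite Z" "card Z = m" using Sigma_delta_class_large[OF y] .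
    have "\<not> card Z \<le> Suc 0" using Z(3) out_valency(2) by simp
    then obtain a b where ab: "a \<in> Z" "b \<in> Z" "a \<noteq> b" using card_le_Suc0_iff_eq[OF Z(2)] by auto
    then have "(a, b) \<in> delta D" using Z(1) delta_sym delta_trans by (meson Image_singleton_iff subsetD)
    then show ?thesis unfolding delta_nontrivial_on_def using ab(3) delta_in_pverts by blast
  qed
  have "(y, z) \<in> delta D" if yz: "(y, z) \<in> cosink" "y \<noteq> z" for y z
  proof -
    note yV = cosink_in_pverts(1)[OF yz(1)]
    obtain C where C: "C \<in> parcs D // edge_reach D" "y \<in> snd ` C" using reach_class_at_sink[OF yV] .
    have Y: "snd ` C = cosink `` {y}" using reach_class_sinks[OF C] .
    have zC: "z \<in> snd ` C" using Y yz(1) by simp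
    obtain \<beta> where \<beta>: "bij_betw \<beta> (snd ` C) (Omega M)"
      and img: "(\<lambda>x. \<beta> ` (parcs D `` {x})) ` fst ` C = m_subsets m M"
      using Sigma_alternet[OF C(1)] by metis
    have \<beta>inj: "inj_on \<beta> (snd ` C)" and \<beta>O: "\<beta> ` snd ` C = Omega M" using \<beta> by (auto simp: bij_betw_def)
    have sV: "x \<in> pverts D" if "x \<in> fst ` C" for x
      using that reach_class_of_mem(2)[OF C(1)] parcs_in_pverts(1) by force
    have outsub: "parcs D `` {x} \<subseteq> snd ` C" if "x \<in> fst ` C" for x
      unfolding reach_class_out[OF C(1) that, symmetric] by force
    \<comment> \<open>At most \<open>m\<close> sinks always have a common in-neighbour, and
      \<open>m\<close> of them form its whole out-neighbourhood because the out-valency is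
      \<open>m\<close>.\<close>
    have realise: "\<exists>x\<in>pverts D. Z \<subseteq> parcs D `` {x} \<and> (card Z = m \<longrightarrow> parcs D `` {x} = Z)"
      if Z: "Z \<subseteq> snd ` C" "finite Z" "card Z \<le> m" for Z
    proof -
      have "card (\<beta> ` Z) \<le> m" using card_image_le[OF Z(2), of \<beta>] Z(3) by simp
      moreover have "\<beta> ` Z \<subseteq> Omega M" using image_mono[OF Z(1), of \<beta>] \<beta>O by simp
      ultimately obtain s where s: "s \<in> m_subsets m M" "\<beta> ` Z \<subseteq> s"
        using m_subset_extend[OF _ finite_imageI[OF Z(2)] _ mM] by metis
      obtain x where x: "x \<in> fst ` C" "\<beta> ` (parcs D `` {x}) = s"
        using s(1) unfolding img[symmetric] by blast
      have "Z \<subseteq> parcs D `` {x}"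
      proof
        fix z assume z: "z \<in> Z"
        then have "\<beta> z \<in> \<beta> ` (parcs D `` {x})" using s(2) x(2) by blast
        then show "z \<in> parcs D `` {x}"
          using inj_on_image_mem_iff[OF \<beta>inj subsetD[OF Z(1) z] outsub[OF x(1)]] by simp
      qed
      moreover have "parcs D `` {x} = Z" if "card Z = m"
        using card_subset_eq[OF out_neighbours(1)[OF sV[OF x(1)]] \<open>Z \<subseteq> parcs D `` {x}\<close>]
          out_neighbours(2)[OF sV[OF x(1)]] that by simp
      ultimately show ?thesis using sV[OF x(1)] by blast
    qed
    have "card {y, z} \<le> m" using out_valency(2) yz(2) by simp
    then obtain u where u: "u \<in> pverts D" "{y, z} \<subseteq> parcs D `` {u}"
      using realise[of "{y, z}"] C(2) zC by auto
    obtain Z where Z: "Z \<subseteq> delta D `` {y}" "finite Z" "card Z = m" using Sigma_delta_class_large[OF yV] .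
    have "Z \<subseteq> snd ` C" using Z(1) delta_imp_cosink[OF nontriv] Y by blast
    then obtain u' where u': "u' \<in> pverts D" "parcs D `` {u'} = Z" using realise[of Z] Z by auto
    \<comment> \<open>This automorphism carries \<open>y\<close> and \<open>z\<close> into
      \<open>Z\<close>, hence into a single delta-class, and delta-equivalence is pulled back along
      it.\<close>
    obtain g where g: "automorphism D g" "g u = u'" using vertex_transitiveE[OF u(1) u'(1)] .
    have "g ` (parcs D `` {u}) = Z" using automorphism_out_neighbours[OF g(1) u(1)] g(2) u'(2) by simp
    then have "g y \<in> Z" "g z \<in> Z" using u(2) by blast+
    then have "(y, g y) \<in> delta D" "(y, g z) \<in> delta D" using Z(1) by blast+
    then have "(g y, g z) \<in> delta D" by (rule delta_trans[OF delta_sym])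
    then show ?thesis using automorphism_delta_iff[OF g(1)] cosink_in_pverts[OF yz(1)] by blast
  qed
  then show ?thesis using delta_imp_cosink[OF nontriv] delta_refl cosink_in_pverts by (metis subrelI subset_antisym)
qed

text \<open>\<open>B\<close> is the sink set of an alternet, which supplies the numbering.
  Delta-classes with equal out-neighbourhoods coincide, so the label determines the in-neighbour of
  \<open>B\<close>.\<close>

lemma Sigma_class_labels:
  assumes "B \<in> pverts (delta_quotient D)"
  shows "\<exists>\<beta>. bij_betw \<beta> B (Omega M) \<and>
    bij_betw (\<lambda>A. \<beta> ` (parcs D `` A)) {A. (A, B) \<in> parcs (delta_quotient D)} (m_subsets m M)"
proof -
  obtain y where y: "y \<in> pverts D" "B = delta D `` {y}" using assms unfolding pverts_quotient by blast
  obtain C where C: "C \<in> parcs D // edge_reach D" "y \<in> snd ` C" using reach_class_at_sink[OF y(1)] .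
  have Y: "snd ` C = B" using reach_class_sinks[OF C] Sigma_delta_eq_cosink y(2) by simp
  obtain \<beta> where \<beta>: "bij_betw \<beta> (snd ` C) (Omega M)"
    and img: "(\<lambda>x. \<beta> ` (parcs D `` {x})) ` fst ` C = m_subsets m M"
    using Sigma_alternet[OF C(1)] by metis
  have \<beta>inj: "inj_on \<beta> (snd ` C)" using \<beta> by (simp add: bij_betw_def)
  have sV: "x \<in> pverts D" if "x \<in> fst ` C" for x
    using that reach_class_of_mem(2)[OF C(1)] parcs_in_pverts(1) by force
  have outsub: "parcs D `` {x} \<subseteq> snd ` C" if "x \<in> fst ` C" for x
    unfolding reach_class_out[OF C(1) that, symmetric] by force
  have cls: "parcs D `` (delta D `` {x}) = parcs D `` {x}" if "x \<in> fst ` C" for x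
    using out_neighbours_delta_class[OF sV[OF that]] .
  have nb: "{A. (A, B) \<in> parcs (delta_quotient D)} = (\<lambda>x. delta D `` {x}) ` fst ` C"
    using quotient_in_neighbours[OF Sigma_delta_eq_cosink C] y(2) by (simp add: setcompr_eq_image)
  have "inj_on (\<lambda>A. \<beta> ` (parcs D `` A)) ((\<lambda>x. delta D `` {x}) ` fst ` C)"
  proof (rule inj_onI)
    fix A A' assume "A \<in> (\<lambda>x. delta D `` {x}) ` fst ` C" "A' \<in> (\<lambda>x. delta D `` {x}) ` fst ` C"
      and eq: "\<beta> ` (parcs D `` A) = \<beta> ` (parcs D `` A')"
    then obtain x x' where A: "A = delta D `` {x}" "A' = delta D `` {x'}" and e: "x \<in> fst ` C" "x' \<in> fst ` C"
      by blast
    have "\<beta> ` (parcs D `` {x}) = \<beta> ` (parcs D `` {x'})" using eq A cls[OF e(1)] cls[OF e(2)] by simp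
    then have "parcs D `` {x} = parcs D `` {x'}"
      using inj_on_image_eq_iff[OF \<beta>inj outsub[OF e(1)] outsub[OF e(2)]] by simp
    then have "(x, x') \<in> delta D" unfolding delta_def using sV e by simp
    then show "A = A'" unfolding A using delta_class_eq_iff sV e by blast
  qed
  moreover have "(\<lambda>A. \<beta> ` (parcs D `` A)) ` (\<lambda>x. delta D `` {x}) ` fst ` C = m_subsets m M"
    unfolding img[symmetric] image_image[of _ "\<lambda>x. delta D `` {x}"] by (rule image_cong[OF refl]) (simp add: cls)
  ultimately show ?thesis using \<beta> Y unfolding nb bij_betw_def by blast
qed

lemma Sigma_D_digraph:
  obtains \<psi> f where "labelled_regular_tree m M (delta_quotient D) \<psi>"
    "dg_isom f (with_proj D) (with_proj (D_digraph M (delta_quotient D) \<psi>))"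
proof -
  let ?Q = "delta_quotient D"
  have eq: "cosink \<subseteq> delta D" using Sigma_delta_eq_cosink by simp
  obtain \<beta> where \<beta>: "\<forall>B\<in>pverts ?Q. bij_betw (\<beta> B) B (Omega M) \<and>
    bij_betw (\<lambda>A. \<beta> B ` (parcs D `` A)) {A. (A, B) \<in> parcs ?Q} (m_subsets m M)"
    using bchoice[OF ballI[OF Sigma_class_labels]] ..
  define \<psi> where "\<psi> B A = \<beta> B ` (parcs D `` A)" for B A
  \<comment> \<open>A finite non-empty acyclic digraph has a vertex without out-neighbours, and the
    quotient has no such vertex.\<close>
  have "infinite (pverts ?Q)"
  proof
    assume fin: "finite (pverts ?Q)"
    have "parcs ?Q \<subseteq> pverts ?Q \<times> pverts ?Q" by (auto simp: delta_quotient_def)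
    then have "finite (parcs ?Q)" using fin by (meson finite_SigmaI finite_subset)
    then have "wf ((parcs ?Q)\<inverse>)" using acyclic_quotient by (rule finite_acyclic_wf_converse)
    moreover obtain v where v: "v \<in> pverts D" using pverts_nonempty by blast
    then have "delta D `` {v} \<in> pverts ?Q" using pverts_quotient by blast
    ultimately obtain A where A: "A \<in> pverts ?Q" "\<And>B. (B, A) \<in> (parcs ?Q)\<inverse> \<Longrightarrow> B \<notin> pverts ?Q"
      using wfE_min by metis
    obtain u where u: "u \<in> pverts D" "A = delta D `` {u}" using A(1) unfolding pverts_quotient by blast
    obtain w where w: "(u, w) \<in> parcs D" using ex_out_neighbour[OF u(1)] .
    then have "(A, delta D `` {w}) \<in> parcs ?Q" unfolding parcs_quotient u(2) by blast
    then show False using A(2) pverts_quotient parcs_in_pverts(2)[OF w] by blast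
  qed
  then have tree: "labelled_regular_tree m M ?Q \<psi>"
    unfolding labelled_regular_tree_def using quotient_tree[OF eq] \<beta> by (auto simp: \<psi>_def[abs_def])
  let ?f = "\<lambda>v. (delta D `` {v}, \<beta> (delta D `` {v}) v)"
  have bij: "bij_betw (\<beta> B) B (Omega M)" if "B \<in> pverts ?Q" for B using \<beta> that by blast
  have Q: "delta D `` {v} \<in> pverts ?Q" "v \<in> delta D `` {v}" if "v \<in> pverts D" for v
    using that pverts_quotient delta_refl by blast+
  have "bij_betw ?f (pverts D) (pverts ?Q \<times> Omega M)"
    unfolding bij_betw_def
  proof
    show "inj_on ?f (pverts D)"
    proof (rule inj_onI)
      fix u v assume uv: "u \<in> pverts D" "v \<in> pverts D" "?f u = ?f v"
      then have eq: "delta D `` {u} = delta D `` {v}" "\<beta> (delta D `` {v}) u = \<beta> (delta D `` {v}) v" by auto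
      then have "u \<in> delta D `` {v}" using Q(2)[OF uv(1)] by simp
      then show "u = v"
        using inj_onD[OF bij_betw_imp_inj_on[OF bij[OF Q(1)[OF uv(2)]]] eq(2)] Q(2)[OF uv(2)] by blast
    qed
    show "?f ` pverts D = pverts ?Q \<times> Omega M"
    proof (intro equalityI subsetI)
      fix p assume "p \<in> ?f ` pverts D"
      then obtain v where v: "v \<in> pverts D" "p = ?f v" by blast
      have "\<beta> (delta D `` {v}) v \<in> Omega M" using bij_betwE[OF bij[OF Q(1)[OF v(1)]]] Q(2)[OF v(1)] by blast
      then show "p \<in> pverts ?Q \<times> Omega M" using v Q(1) by simp
    next
      fix p assume "p \<in> pverts ?Q \<times> Omega M"
      then obtain B a where p: "p = (B, a)" "B \<in> pverts ?Q" "a \<in> Omega M" by blast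
      have "a \<in> \<beta> B ` B" using bij[OF p(2)] p(3) by (simp add: bij_betw_def)
      then obtain v where v: "v \<in> B" "a = \<beta> B v" by blast
      have "B \<in> pverts D // delta D" using p(2) by (simp add: delta_quotient_def)
      then have "B = delta D `` {v}" "v \<in> pverts D" using delta_class_of_mem v(1) by blast+
      then show "p \<in> ?f ` pverts D" using p(1) v(2) by blast
    qed
  qed
  moreover have "(u, v) \<in> parcs D \<longleftrightarrow> (?f u, ?f v) \<in> parcs (D_digraph M ?Q \<psi>)"
    if uv: "u \<in> pverts D" "v \<in> pverts D" for u v
  proof -
    let ?A = "delta D `` {u}" and ?B = "delta D `` {v}"
    have "\<beta> ?A u \<in> Omega M" using bij_betwE[OF bij[OF Q(1)[OF uv(1)]]] Q(2)[OF uv(1)] by blast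
    then have "(?f u, ?f v) \<in> parcs (D_digraph M ?Q \<psi>) \<longleftrightarrow> (?A, ?B) \<in> parcs ?Q \<and> \<beta> ?B v \<in> \<beta> ?B ` (parcs D `` {u})"
      unfolding D_digraph_def \<psi>_def using out_neighbours_delta_class[OF uv(1)] by auto
    also have "\<dots> \<longleftrightarrow> (u, v) \<in> parcs D"
    proof
      assume r: "(?A, ?B) \<in> parcs ?Q \<and> \<beta> ?B v \<in> \<beta> ?B ` (parcs D `` {u})"
      then obtain w where w: "(u, w) \<in> parcs D" "\<beta> ?B v = \<beta> ?B w" by auto
      \<comment> \<open>\<open>\<beta> ?B\<close> is injective only on \<open>?B\<close>, so
        \<open>w\<close> has to be placed in \<open>?B\<close> before it can be compared with
        \<open>v\<close>. This uses that \<open>?A\<close> has just one out-neighbour in the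
        quotient.\<close>
      then have "?B = delta D `` {w}" using quotient_arc_from[OF eq w(1), of ?B] r by simp
      then have "w \<in> ?B" using Q(2)[OF parcs_in_pverts(2)[OF w(1)]] by simp
      then have "v = w"
        using inj_onD[OF bij_betw_imp_inj_on[OF bij[OF Q(1)[OF uv(2)]]] w(2) Q(2)[OF uv(2)]] by simp
      then show "(u, v) \<in> parcs D" using w(1) by simp
    qed (use parcs_quotient in blast)
    finally show ?thesis by simp
  qed
  ultimately have "dg_isom ?f (with_proj D) (with_proj (D_digraph M ?Q \<psi>))"
    unfolding dg_isom_def by (simp add: D_digraph_def)
  then show ?thesis using that tree by blast
qed

end

end

theorem theorem5p8:
  fixes D :: "'a pair_pre_digraph" and m :: nat
  assumes digraph: "pair_loopfree_digraph D"
    and infinite: "infinite (pverts D)"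
    and connected: "connected (with_proj D)"
    and distance_transitive: "distance_transitive D"
    and homogeneous: "weakly_descendant_homogeneous D"
    and out_valency: "has_out_valency D m" "1 < m"
    and no_directed_cycles: "acyclic (parcs D)"
    and not_universal: "\<not> reachability_universal D"
  shows "((\<forall>A\<in>alternets D. class_C A) \<longrightarrow>
            delta_nontrivial_on D (pverts D) \<and>
            directed_tree (delta_quotient D) \<and>
            has_out_valency (delta_quotient D) 1 \<and>
            (\<exists>k. has_in_valency (delta_quotient D) k \<and>
               (\<forall>A\<in>alternets D. card {delta D `` {x} | x. x \<in> sources A} = k)))
         \<and>
         (\<forall>M::enat. enat m \<le> M \<and>
            (\<forall>A\<in>alternets D. digraph_iso (with_proj A) (with_proj (Sigma_digraph m M))) \<longrightarrow>
            (\<forall>(T :: 't pair_pre_digraph) \<phi>. labelled_regular_tree m M T \<phi> \<longrightarrow>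
               digraph_iso (with_proj D) (with_proj (D_digraph M T \<phi>))))"
proof -
  interpret D: pair_loopfree_digraph D by (rule digraph)
  interpret acyclic_homogeneous_digraph D m
    using connected homogeneous out_valency no_directed_cycles by unfold_locales
  have "digraph_iso (with_proj D) (with_proj (D_digraph M T \<phi>))"
    if mM: "enat m \<le> M"
      and iso: "\<forall>A\<in>alternets D. digraph_iso (with_proj A) (with_proj (Sigma_digraph m M))"
      and T: "labelled_regular_tree m M T \<phi>"
    for M and T :: "'t pair_pre_digraph" and \<phi>
  proof -
    \<comment> \<open>The tree \<open>T\<close> is arbitrary and its type is unrelated to that of
      \<open>D\<close>. The quotient serves as an intermediate tree, from which uniqueness leads to
      \<open>T\<close>.\<close>
    obtain \<psi> f where Q: "labelled_regular_tree m M (delta_quotient D) \<psi>"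
      and f: "dg_isom f (with_proj D) (with_proj (D_digraph M (delta_quotient D) \<psi>))"
      using Sigma_D_digraph[OF mM iso] .
    obtain h where "dg_isom h (with_proj (D_digraph M (delta_quotient D) \<psi>)) (with_proj (D_digraph M T \<phi>))"
      using D_digraph_unique[OF Q T mM] by blast
    then show ?thesis
      using dg_isom_trans[OF f] digraph_iso_iff[OF D.pair_wf_digraph_axioms pair_wf_D_digraph[OF T]] by blast
  qed
  then show ?thesis using class_C_quotient by blast
qed

end
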